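(* Let $E\subset\mathbb{R}^{b}$ and $\Omega\subset\mathbb{R}^{k}$ be nonempty compact sets, let $p>1$ and $r>0$, and let $K:E\times\Omega\times\mathbb{R}^m\to\mathbb{R}^n$ satisfy conditions (A), (B), (C) listed in the context. Then for every $\varepsilon>0$ there exist $\gamma_*(\varepsilon)>0$, $\Delta_*(\varepsilon)>0$, $\delta_*(\varepsilon)>0$ and $\sigma_*(\varepsilon)=\sigma_*(\varepsilon,\gamma_*(\varepsilon))>0$ such that for each $\Delta\in(0,\Delta_*(\varepsilon)]$, each $\delta\in(0,\delta_*(\varepsilon)]$ and each $\sigma\in(0,\sigma_*(\varepsilon)]$ the following holds. Whenever $\Upsilon_1=\{\Omega_1,\ldots,\Omega_M\}$ is a finite $\Delta$-partition of $\Omega$, $\Upsilon_2=\{E_1,\ldots,E_N\}$ is a finite $\Delta$-partition of $E$, $\xi_i\in E_i$ ($i=1,\ldots,N$) are arbitrarily chosen points, $\Lambda=\{0=w_0<w_1<\ldots<w_q=\gamma_*(\varepsilon)\}$ is a uniform partition of the interval $[0,\gamma_*(\varepsilon)]$ with diameter $\delta=w_{\lambda+1}-w_\lambda$ ($\lambda=0,1,\ldots,q-1$), and $S_\sigma$ is a finite $\sigma$-net on the unit sphere $S=\{x\in\mathbb{R}^m:\|x\|=1\}$, the inequalities $$H_{C}\left(\mathcal{U}_{p,r},\ \mathcal{U}_{p,r}^{\gamma_*(\varepsilon),\Upsilon_1,\Lambda,\sigma}\right)<\varepsilon$$ and $$H_{b+n}\left(\mathcal{F}_{p,r},\ \mathcal{F}_{p,r}^{\gamma_*(\varepsilon),\Upsilon_1,\Lambda,\sigma,\Upsilon_2}\right)<\varepsilon$$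 are satisfied, where all the sets are as defined in the context.
   Context: Throughout, $\|\cdot\|$ denotes the Euclidean norm, and $L_p(\Omega;\mathbb{R}^m)$ is the space of Lebesgue measurable functions $x:\Omega\to\mathbb{R}^m$ with $\|x\|_p=\left(\int_\Omega\|x(s)\|^p\,ds\right)^{1/p}<+\infty$. The conditions on $K:E\times\Omega\times\mathbb{R}^m\to\mathbb{R}^n$ are: (A) $K$ is continuous. (B) There exists $l_0>0$ such that $\|K(\xi,s,x_1)-K(\xi,s,x_2)\|\le l_0\|x_1-x_2\|$ for all $\xi\in E$, $s\in\Omega$, $x_1,x_2\in\mathbb{R}^m$. (C) There exist functions $\omega:\Omega\times\mathbb{R}^m\to[0,+\infty)$ and $\varphi:[0,+\infty)\to[0,+\infty)$ and numbers $\beta_0\ge0$, $\beta_1\ge0$ such that $\omega(s,x)\le\beta_0\|x\|+\beta_1$ for all $(s,x)\in\Omega\times\mathbb{R}^m$, $\varphi(0)=0$, $\varphi(\tau)\to0^+$ as $\tau\to0^+$, and $\|K(\xi_1,s,x)-K(\xi_2,s,x)\|\le\omega(s,x)\,\varphi(\|\xi_1-\xi_2\|)$ for all $\xi_1,\xi_2\in E$, $s\in\Omega$, $x\in\mathbb{R}^m$. The Urysohn operator is $U(x(\cdot))|(\xi)=\int_\Omega K(\xi,s,x(s))\,ds$, $\xi\in E$. The closed ball is $V_{p,r}=\{x(\cdot)\in L_p(\Omega;\mathbb{R}^m):\|x(\cdot)\|_p\le r\}$. Its image is $\mathcal{U}_{p,r}=\{U(x(\cdot))|(\cdot):x(\cdot)\in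 V_{p,r}\}$, which is a subset of $C(E;\mathbb{R}^n)$, the space of continuous functions $w:E\to\mathbb{R}^n$ with the norm $\|w\|_C=\max_{\xi\in E}\|w(\xi)\|$. Its integral funnel is $\mathcal{F}_{p,r}=\{(\xi,y(\xi))\in E\times\mathbb{R}^n:\xi\in E,\ y(\cdot)\in\mathcal{U}_{p,r}\}$. A finite $\Delta$-partition of a set $Q\subset\mathbb{R}^{d}$ is a finite system $\{Q_1,\ldots,Q_T\}$ of pairwise disjoint Lebesgue measurable subsets of $Q$ with $Q=\bigcup_{i=1}^TQ_i$ and $\mathrm{diam}(Q_i)=\sup\{\|x-y\|:x,y\in Q_i\}\le\Delta$ for every $i$. A finite $\sigma$-net on $S$ is a finite set $S_\sigma=\{b_1,\ldots,b_g\}\subset S$ such that for every $a\in S$ there is $b_i\in S_\sigma$ with $\|a-b_i\|\le\sigma$. For $\gamma>0$, a finite $\Delta$-partition $\Upsilon_1=\{\Omega_1,\ldots,\Omega_M\}$ of $\Omega$, a uniform partition $\Lambda=\{0=w_0<\ldots<w_q=\gamma\}$ of $[0,\gamma]$ and a finite $\sigma$-net $S_\sigma$ on $S$, put $$V_{p,r}^{\gamma,\Upsilon_1,\Lambda,\sigma}=\{x(\cdot)\in V_{p,r}: \text{for each } j=1,\ldots,M \text{ there are } w_{\lambda_j}\in\Lambda,\ b_{i_j}\in S_\sigma \text{ with } x(s)=w_{\lambda_j}b_{i_j}\text{ for every } s\in\Omega_j\},$$ $$\mathcal{U}_{p,r}^{\gamma,\Upsilon_1,\Lambda,\sigma}=\{U(x(\cdot))|(\cdot):x(\cdot)\in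 V_{p,r}^{\gamma,\Upsilon_1,\Lambda,\sigma}\},\qquad \mathcal{U}_{p,r}^{\gamma,\Upsilon_1,\Lambda,\sigma}(\xi)=\{y(\xi):y(\cdot)\in\mathcal{U}_{p,r}^{\gamma,\Upsilon_1,\Lambda,\sigma}\},\ \xi\in E.$$ For a finite $\Delta$-partition $\Upsilon_2=\{E_1,\ldots,E_N\}$ of $E$ and chosen points $\xi_i\in E_i$, put $$\mathcal{F}_{p,r}^{\gamma,\Upsilon_1,\Lambda,\sigma,\Upsilon_2}=\bigcup_{i=1}^N\{\xi_i\}\times\mathcal{U}_{p,r}^{\gamma,\Upsilon_1,\Lambda,\sigma}(\xi_i)\subset\mathbb{R}^{b+n}.$$ $H_C$ denotes the Hausdorff distance between subsets of $C(E;\mathbb{R}^n)$ (with respect to $\|\cdot\|_C$), and $H_{b+n}$ denotes the Hausdorff distance between subsets of $\mathbb{R}^{b+n}$ (with respect to the Euclidean norm). *)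

theory Defs
  imports "HOL-Analysis.Analysis"
begin

section \<open>Conditions on the kernel\<close>

definition kernel_continuous ::
  "'b::euclidean_space set \<Rightarrow> 'k::euclidean_space set
    \<Rightarrow> ('b \<Rightarrow> 'k \<Rightarrow> 'm::euclidean_space \<Rightarrow> 'n::euclidean_space) \<Rightarrow> bool" where
  "kernel_continuous E \<Omega> K \<longleftrightarrow> continuous_on (E \<times> \<Omega> \<times> UNIV) (\<lambda>(\<xi>, s, x). K \<xi> s x)"

definition kernel_lipschitz ::
  "'b::euclidean_space set \<Rightarrow> 'k::euclidean_space set
    \<Rightarrow> ('b \<Rightarrow> 'k \<Rightarrow> 'm::euclidean_space \<Rightarrow> 'n::euclidean_space) \<Rightarrow> bool" where
  "kernel_lipschitz E \<Omega> K \<longleftrightarrow>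
    (\<exists>l0>0. \<forall>\<xi>\<in>E. \<forall>s\<in>\<Omega>. \<forall>x1 x2.
       norm (K \<xi> s x1 - K \<xi> s x2) \<le> l0 * norm (x1 - x2))"

definition kernel_modulus ::
  "'b::euclidean_space set \<Rightarrow> 'k::euclidean_space set
    \<Rightarrow> ('b \<Rightarrow> 'k \<Rightarrow> 'm::euclidean_space \<Rightarrow> 'n::euclidean_space) \<Rightarrow> bool" where
  "kernel_modulus E \<Omega> K \<longleftrightarrow>
    (\<exists>(\<omega> :: 'k \<Rightarrow> 'm \<Rightarrow> real) (\<phi> :: real \<Rightarrow> real) \<beta>0 \<beta>1.
       \<beta>0 \<ge> 0 \<and> \<beta>1 \<ge> 0 \<and>
       (\<forall>s\<in>\<Omega>. \<forall>x. 0 \<le> \<omega> s x \<and> \<omega> s x \<le> \<beta>0 * norm x + \<beta>1) \<and>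
       (\<forall>\<tau>\<ge>0. 0 \<le> \<phi> \<tau>) \<and> \<phi> 0 = 0 \<and> (\<phi> \<longlongrightarrow> 0) (at_right 0) \<and>
       (\<forall>\<xi>1\<in>E. \<forall>\<xi>2\<in>E. \<forall>s\<in>\<Omega>. \<forall>x.
          norm (K \<xi>1 s x - K \<xi>2 s x) \<le> \<omega> s x * \<phi> (norm (\<xi>1 - \<xi>2))))"


section \<open>The ball in $L_p$, the Urysohn operator and its integral funnel\<close>

text \<open>
  Elements of $L_p(\Omega)$ are functions, not classes modulo null sets, and their values outside
  \<open>\<Omega>\<close> are irrelevant.
\<close>

definition Lp_space :: "real \<Rightarrow> 'k::euclidean_space set \<Rightarrow> ('k \<Rightarrow> 'm::euclidean_space) set" where
  "Lp_space p \<Omega> = {x \<in> borel_measurable (lebesgue_on \<Omega>).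
     integrable (lebesgue_on \<Omega>) (\<lambda>s. norm (x s) powr p)}"

definition Lp_norm :: "real \<Rightarrow> 'k::euclidean_space set \<Rightarrow> ('k \<Rightarrow> 'm::euclidean_space) \<Rightarrow> real" where
  "Lp_norm p \<Omega> x = (LINT s|lebesgue_on \<Omega>. norm (x s) powr p) powr (1 / p)"

definition Lp_ball ::
  "real \<Rightarrow> real \<Rightarrow> 'k::euclidean_space set \<Rightarrow> ('k \<Rightarrow> 'm::euclidean_space) set" where
  "Lp_ball p r \<Omega> = {x \<in> Lp_space p \<Omega>. Lp_norm p \<Omega> x \<le> r}"

text \<open>
  The library metric on \<open>cfunspace\<close> is the supremum metric, but it is defined to be 0 as soon as an
  argument lies outside the space; in particular elements have to be extensional on the domain.
  Hence the \<open>restrict\<close> in the operator below; see also the lemma \<open>urysohn_image_subset_cfunspace\<close>.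
\<close>

abbreviation C_space :: "'b::euclidean_space set \<Rightarrow> ('b \<Rightarrow> 'n::euclidean_space) metric" where
  "C_space E \<equiv> cfunspace (top_of_set E) euclidean_metric"

definition urysohn ::
  "'b::euclidean_space set \<Rightarrow> 'k::euclidean_space set
    \<Rightarrow> ('b \<Rightarrow> 'k \<Rightarrow> 'm::euclidean_space \<Rightarrow> 'n::euclidean_space) \<Rightarrow> ('k \<Rightarrow> 'm) \<Rightarrow> 'b \<Rightarrow> 'n" where
  "urysohn E \<Omega> K x = (\<lambda>\<xi>\<in>E. LINT s|lebesgue_on \<Omega>. K \<xi> s (x s))"

definition urysohn_image ::
  "'b::euclidean_space set \<Rightarrow> 'k::euclidean_space set
    \<Rightarrow> ('b \<Rightarrow> 'k \<Rightarrow> 'm::euclidean_space \<Rightarrow> 'n::euclidean_space) \<Rightarrow> real \<Rightarrow> real \<Rightarrow> ('b \<Rightarrow> 'n) set" where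
  "urysohn_image E \<Omega> K p r = urysohn E \<Omega> K ` Lp_ball p r \<Omega>"

definition integral_funnel ::
  "'b::euclidean_space set \<Rightarrow> 'k::euclidean_space set
    \<Rightarrow> ('b \<Rightarrow> 'k \<Rightarrow> 'm::euclidean_space \<Rightarrow> 'n::euclidean_space) \<Rightarrow> real \<Rightarrow> real \<Rightarrow> ('b \<times> 'n) set" where
  "integral_funnel E \<Omega> K p r = {(\<xi>, y \<xi>) |\<xi> y. \<xi> \<in> E \<and> y \<in> urysohn_image E \<Omega> K p r}"


section \<open>Partitions and nets\<close>

text \<open>The system is $Q_1,\dots,Q_T$, i.e. only the values \<open>P i\<close> for \<open>i \<in> {1..T}\<close> matter.
  Boundedness is stated because the library \<open>diameter\<close> is meaningful only for bounded sets.\<close>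

definition finite_partition ::
  "real \<Rightarrow> 'a::euclidean_space set \<Rightarrow> nat \<Rightarrow> (nat \<Rightarrow> 'a set) \<Rightarrow> bool" where
  "finite_partition \<Delta> Q T P \<longleftrightarrow>
     (\<forall>i\<in>{1..T}. P i \<in> sets lebesgue \<and> P i \<subseteq> Q \<and> bounded (P i) \<and> diameter (P i) \<le> \<Delta>) \<and>
     disjoint_family_on P {1..T} \<and> Q = (\<Union>i\<in>{1..T}. P i)"

definition uniform_partition :: "real \<Rightarrow> real \<Rightarrow> nat \<Rightarrow> (nat \<Rightarrow> real) \<Rightarrow> bool" where
  "uniform_partition \<gamma> \<delta> q w \<longleftrightarrow>
     w 0 = 0 \<and> w q = \<gamma> \<and> (\<forall>l<q. w l < w (l + 1) \<and> w (l + 1) - w l = \<delta>)"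

definition finite_net :: "real \<Rightarrow> 'a::euclidean_space set \<Rightarrow> 'a set \<Rightarrow> bool" where
  "finite_net \<sigma> S B \<longleftrightarrow> finite B \<and> B \<subseteq> S \<and> (\<forall>a\<in>S. \<exists>b\<in>B. norm (a - b) \<le> \<sigma>)"


section \<open>Discretized ball, image and funnel\<close>

definition discrete_Lp_ball ::
  "real \<Rightarrow> real \<Rightarrow> 'k::euclidean_space set \<Rightarrow> nat \<Rightarrow> (nat \<Rightarrow> 'k set) \<Rightarrow> nat \<Rightarrow> (nat \<Rightarrow> real) \<Rightarrow>
    'm::euclidean_space set \<Rightarrow> ('k \<Rightarrow> 'm) set" where
  "discrete_Lp_ball p r \<Omega> M \<Omega>s q w B =
     {x \<in> Lp_ball p r \<Omega>. \<forall>j\<in>{1..M}. \<exists>l\<in>{0..q}. \<exists>b\<in>B. \<forall>s\<in>\<Omega>s j. x s = w l *\<^sub>R b}"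

definition discrete_image ::
  "'b::euclidean_space set \<Rightarrow> 'k::euclidean_space set
    \<Rightarrow> ('b \<Rightarrow> 'k \<Rightarrow> 'm::euclidean_space \<Rightarrow> 'n::euclidean_space) \<Rightarrow> real \<Rightarrow> real \<Rightarrow>
    nat \<Rightarrow> (nat \<Rightarrow> 'k set) \<Rightarrow> nat \<Rightarrow> (nat \<Rightarrow> real) \<Rightarrow> 'm set \<Rightarrow> ('b \<Rightarrow> 'n) set" where
  "discrete_image E \<Omega> K p r M \<Omega>s q w B =
     urysohn E \<Omega> K ` discrete_Lp_ball p r \<Omega> M \<Omega>s q w B"

definition discrete_funnel ::
  "'b::euclidean_space set \<Rightarrow> 'k::euclidean_space set
    \<Rightarrow> ('b \<Rightarrow> 'k \<Rightarrow> 'm::euclidean_space \<Rightarrow> 'n::euclidean_space) \<Rightarrow> real \<Rightarrow> real \<Rightarrow>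
    nat \<Rightarrow> (nat \<Rightarrow> 'k set) \<Rightarrow> nat \<Rightarrow> (nat \<Rightarrow> real) \<Rightarrow> 'm set \<Rightarrow> nat \<Rightarrow> (nat \<Rightarrow> 'b) \<Rightarrow>
    ('b \<times> 'n) set" where
  "discrete_funnel E \<Omega> K p r M \<Omega>s q w B N \<xi> =
     (\<Union>i\<in>{1..N}. {\<xi> i} \<times> {y (\<xi> i) |y. y \<in> discrete_image E \<Omega> K p r M \<Omega>s q w B})"


section \<open>Hausdorff distance\<close>

text \<open>
  Extended-real valued, so that unbounded or empty sets never yield a spurious finite value.
  On \<open>'b \<times> 'n\<close> the library metric is the Euclidean one.
\<close>

definition hausdorff_distance :: "'a metric \<Rightarrow> 'a set \<Rightarrow> 'a set \<Rightarrow> ennreal" where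
  "hausdorff_distance m A B =
     max (SUP a\<in>A. INF b\<in>B. ennreal (mdist m a b)) (SUP b\<in>B. INF a\<in>A. ennreal (mdist m b a))"


section \<open>The images consist of continuous functions\<close>

lemma urysohn_integrable:
  assumes \<Omega>: "compact \<Omega>" and p: "p > 1"
    and A: "kernel_continuous E \<Omega> K" and B: "kernel_lipschitz E \<Omega> K"
    and x: "x \<in> Lp_space p \<Omega>" and \<xi>: "\<xi> \<in> E"
  shows "integrable (lebesgue_on \<Omega>) (\<lambda>s. norm (x s))"
    and "integrable (lebesgue_on \<Omega>) (\<lambda>s. K \<xi> s (x s))"
proof -
  have ms: "\<Omega> \<in> sets lebesgue" "\<Omega> \<in> lmeasurable"
    using \<Omega> lmeasurable_compact fmeasurableD by blast+
  interpret finite_measure "lebesgue_on \<Omega>"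
    using ms by (intro finite_measure_lebesgue_on)
  have xm [measurable]: "x \<in> borel_measurable (lebesgue_on \<Omega>)"
    and xi: "integrable (lebesgue_on \<Omega>) (\<lambda>s. norm (x s) powr p)"
    using x by (auto simp: Lp_space_def)
  show ix: "integrable (lebesgue_on \<Omega>) (\<lambda>s. norm (x s))"
  proof (rule Bochner_Integration.integrable_bound)
    show "integrable (lebesgue_on \<Omega>) (\<lambda>s. 1 + norm (x s) powr p)"
      using xi by simp
    have "t \<le> 1 + t powr p" if "t \<ge> 0" for t :: real
    proof (cases "t \<le> 1")
      case True
      have "0 \<le> t powr p" by simp
      then show ?thesis using True by linarith
    next
      case False
      then have "t powr 1 \<le> t powr p" using p by (intro powr_mono) auto
      then show ?thesis using False by simp
    qed
    then show "AE s in lebesgue_on \<Omega>. norm (norm (x s)) \<le> norm (1 + norm (x s) powr p)"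
      by (intro AE_I2) (smt (verit) norm_ge_zero real_norm_def)
  qed simp
  have c: "continuous_on (\<Omega> \<times> UNIV) (\<lambda>z. K \<xi> (fst z) (snd z))"
  proof -
    have "continuous_on (\<Omega> \<times> UNIV)
            ((\<lambda>(\<xi>, s, x). K \<xi> s x) \<circ> (\<lambda>z. (\<xi>, fst z, snd z)))"
      using \<xi> A unfolding kernel_continuous_def
      by (intro continuous_on_compose continuous_intros) (auto elim!: continuous_on_subset)
    then show ?thesis by (simp add: o_def case_prod_unfold)
  qed
  have Km: "(\<lambda>s. K \<xi> s (x s)) \<in> borel_measurable (lebesgue_on \<Omega>)"
  proof -
    have 1: "(\<lambda>z. K \<xi> (fst z) (snd z)) \<in> borel_measurable (restrict_space borel (\<Omega> \<times> UNIV))"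
      using c by (rule borel_measurable_continuous_on_restrict)
    have id: "(\<lambda>s. s) \<in> borel_measurable (lebesgue_on \<Omega>)"
      using ms(1) by (intro continuous_imp_measurable_on_sets_lebesgue continuous_on_id)
    have 2: "(\<lambda>s. (s, x s)) \<in> measurable (lebesgue_on \<Omega>) (restrict_space borel (\<Omega> \<times> UNIV))"
      using id xm by (intro measurable_restrict_space2 borel_measurable_Pair) auto
    show ?thesis
      using measurable_compose [OF 2 1] by simp
  qed
  obtain l0 where l0: "l0 > 0"
      "\<And>s x1 x2. s \<in> \<Omega> \<Longrightarrow> norm (K \<xi> s x1 - K \<xi> s x2) \<le> l0 * norm (x1 - x2)"
    using B \<xi> unfolding kernel_lipschitz_def by metis
  have "continuous_on \<Omega> ((\<lambda>z. K \<xi> (fst z) (snd z)) \<circ> (\<lambda>s. (s, 0)))"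
    by (intro continuous_on_compose continuous_intros continuous_on_subset [OF c]) auto
  then have "bounded ((\<lambda>s. K \<xi> s 0) ` \<Omega>)"
    using \<Omega> by (intro compact_imp_bounded compact_continuous_image) (auto simp: o_def)
  then obtain k where k: "\<And>s. s \<in> \<Omega> \<Longrightarrow> norm (K \<xi> s 0) \<le> k"
    by (auto simp: bounded_iff)
  show "integrable (lebesgue_on \<Omega>) (\<lambda>s. K \<xi> s (x s))"
  proof (rule Bochner_Integration.integrable_bound [OF _ Km])
    show "integrable (lebesgue_on \<Omega>) (\<lambda>s. k + l0 * norm (x s))"
      using ix by simp
    have "norm (K \<xi> s (x s)) \<le> norm (k + l0 * norm (x s))" if "s \<in> \<Omega>" for s
    proof -
      have "norm (K \<xi> s (x s)) \<le> norm (K \<xi> s 0) + norm (K \<xi> s (x s) - K \<xi> s 0)"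
        by (metis norm_triangle_sub)
      also have "\<dots> \<le> k + l0 * norm (x s)"
        using k [OF that] l0(2) [OF that, of "x s" 0] by simp
      finally show ?thesis by simp
    qed
    then show "AE s in lebesgue_on \<Omega>. norm (K \<xi> s (x s)) \<le> norm (k + l0 * norm (x s))"
      by (intro AE_I2) simp
  qed
qed

lemma urysohn_in_cfunspace:
  assumes E: "compact E" and \<Omega>: "compact \<Omega>" and p: "p > 1"
    and A: "kernel_continuous E \<Omega> K" and B: "kernel_lipschitz E \<Omega> K" and C: "kernel_modulus E \<Omega> K"
    and x: "x \<in> Lp_space p \<Omega>"
  shows "urysohn E \<Omega> K x \<in> mspace (C_space E)"
proof -
  note int = urysohn_integrable [OF \<Omega> p A B x]
  interpret finite_measure "lebesgue_on \<Omega>"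
    using \<Omega> by (intro finite_measure_lebesgue_on lmeasurable_compact)
  obtain \<omega> :: "'b \<Rightarrow> 'c \<Rightarrow> real" and \<phi> :: "real \<Rightarrow> real" and \<beta>0 \<beta>1
    where om: "\<And>s z. s \<in> \<Omega> \<Longrightarrow> \<omega> s z \<le> \<beta>0 * norm z + \<beta>1"
      and ph: "\<And>\<tau>. \<tau> \<ge> 0 \<Longrightarrow> 0 \<le> \<phi> \<tau>" "\<phi> 0 = 0" "(\<phi> \<longlongrightarrow> 0) (at_right 0)"
      and K: "\<And>\<xi>1 \<xi>2 s z. \<xi>1 \<in> E \<Longrightarrow> \<xi>2 \<in> E \<Longrightarrow> s \<in> \<Omega> \<Longrightarrow>
          norm (K \<xi>1 s z - K \<xi>2 s z) \<le> \<omega> s z * \<phi> (norm (\<xi>1 - \<xi>2))"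
    using C unfolding kernel_modulus_def by metis
  define c where "c = (LINT s|lebesgue_on \<Omega>. \<beta>0 * norm (x s) + \<beta>1)"
  have diff: "norm (urysohn E \<Omega> K x a - urysohn E \<Omega> K x b) \<le> c * \<phi> (norm (a - b))"
    if "a \<in> E" "b \<in> E" for a b
  proof -
    have ia: "integrable (lebesgue_on \<Omega>) (\<lambda>s. K a s (x s) - K b s (x s))"
      using int(2) that by (intro Bochner_Integration.integrable_diff)
    have ib: "integrable (lebesgue_on \<Omega>) (\<lambda>s. (\<beta>0 * norm (x s) + \<beta>1) * \<phi> (norm (a - b)))"
      using int(1) that by simp
    have "norm (urysohn E \<Omega> K x a - urysohn E \<Omega> K x b)
        = norm (LINT s|lebesgue_on \<Omega>. K a s (x s) - K b s (x s))"
      using that int(2) by (simp add: urysohn_def Bochner_Integration.integral_diff)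
    also have "\<dots> \<le> (LINT s|lebesgue_on \<Omega>. norm (K a s (x s) - K b s (x s)))"
      by (rule integral_norm_bound)
    also have "\<dots> \<le> (LINT s|lebesgue_on \<Omega>. (\<beta>0 * norm (x s) + \<beta>1) * \<phi> (norm (a - b)))"
    proof (rule integral_mono)
      fix s assume "s \<in> space (lebesgue_on \<Omega>)"
      then have s: "s \<in> \<Omega>" by simp
      show "norm (K a s (x s) - K b s (x s)) \<le> (\<beta>0 * norm (x s) + \<beta>1) * \<phi> (norm (a - b))"
        using K [OF that s, of "x s"] mult_right_mono [OF om [OF s, of "x s"] ph(1) [of "norm (a - b)"]]
        by simp
    qed (use ia ib in auto)
    also have "\<dots> = c * \<phi> (norm (a - b))"
      by (simp add: c_def)
    finally show ?thesis .
  qed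
  have "continuous_on E (urysohn E \<Omega> K x)"
    unfolding continuous_on_def
  proof
    fix a assume a: "a \<in> E"
    have "(\<phi> \<longlongrightarrow> 0) (at 0 within {0..})"
      using ph(3) by (simp add: at_within_Ici_at_right)
    then have "((\<lambda>t. \<phi> (norm (t - a))) \<longlongrightarrow> 0) (at a within E)"
    proof (rule filterlim_compose)
      have "((\<lambda>t. norm (t - a)) \<longlongrightarrow> 0) (at a within E)"
        by (intro tendsto_eq_intros) auto
      then show "filterlim (\<lambda>t. norm (t - a)) (at 0 within {0..}) (at a within E)"
        by (auto simp: filterlim_at eventually_at_filter)
    qed
    then have "((\<lambda>t. c * \<phi> (norm (t - a))) \<longlongrightarrow> 0) (at a within E)"
      by (rule tendsto_mult_right_zero)
    then have "((\<lambda>t. urysohn E \<Omega> K x t - urysohn E \<Omega> K x a) \<longlongrightarrow> 0) (at a within E)"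
      by (rule Lim_null_comparison [rotated])
        (use diff a in \<open>auto simp: eventually_at_filter\<close>)
    then show "(urysohn E \<Omega> K x \<longlongrightarrow> urysohn E \<Omega> K x a) (at a within E)"
      using Lim_null by blast
  qed
  moreover from this have "bounded (urysohn E \<Omega> K x ` E)"
    using E by (intro compact_imp_bounded compact_continuous_image)
  moreover have "Metric_space.mbounded UNIV dist S \<longleftrightarrow> bounded S" for S :: "'d set"
    by simp
  ultimately show ?thesis
    by (auto simp: urysohn_def)
qed

lemma urysohn_image_subset_cfunspace:
  assumes "compact E" "compact \<Omega>" "p > 1"
    and "kernel_continuous E \<Omega> K" "kernel_lipschitz E \<Omega> K" "kernel_modulus E \<Omega> K"
  shows "discrete_image E \<Omega> K p r M \<Omega>s q w B \<subseteq> urysohn_image E \<Omega> K p r"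
    and "urysohn_image E \<Omega> K p r \<subseteq> mspace (C_space E)"
  using urysohn_in_cfunspace [OF assms]
  by (auto simp: discrete_image_def discrete_Lp_ball_def urysohn_image_def Lp_ball_def
      simp del: mspace_cfunspace)

end

theory Submission
  imports Defs "HOL-Complex_Analysis.Great_Picard"
begin

text \<open>
  The image of the ball under the Urysohn operator \<open>U\<close> is totally bounded in \<open>C(E)\<close>, although the
  ball itself is in general not totally bounded in \<open>L\<^sub>1\<close>. This reduces the theorem to finitely many
  functions, and the discretization parameters can be adapted to these few functions.

  On \<open>V\<^sub>p\<^sub>,\<^sub>r\<close> the \<open>L\<^sub>1\<close> norm is bounded, so the Lipschitz condition on \<open>K\<close> bounds the functions
  \<open>U x\<close> uniformly, and the modulus condition makes them equicontinuous. By Arzela--Ascoli the image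
  is totally bounded and has a finite net. Each net point comes from some \<open>x\<close> in the ball, and
  since \<open>U\<close> is Lipschitz from \<open>L\<^sub>1\<close> to \<open>C(E)\<close>, \<open>x\<close> may be replaced by a continuous function \<open>g\<close> that
  is \<open>L\<^sub>1\<close>-close to it and still in the ball (\<open>Lp_ball_approx_continuous\<close>). The result is
  \<open>urysohn_image_continuous_net\<close>.

  The finitely many continuous functions \<open>g\<close> have a common bound \<open>\<gamma>\<close> and a common modulus of
  continuity on \<open>\<Omega>\<close>, so on a fine partition each one is nearly constant on every cell. There its
  value is replaced by \<open>w\<^sub>l b\<close>, where \<open>b\<close> is a point of the net close to the direction of \<open>g\<close> and \<open>w\<^sub>l\<close>
  is rounded down to at most the infimum of \<open>\<parallel>g\<parallel>\<close> on the cell. Rounding down makes the step function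
  pointwise no larger than \<open>g\<close> in norm, so that it stays in the ball, and it is uniformly close to
  \<open>g\<close> (\<open>discrete_Lp_ball_approx\<close>). As \<open>\<gamma>\<close> and the mesh depend on the finite net only, this gives
  the bound for the images.

  For the funnels, equicontinuity allows moving a point \<open>\<xi>\<close> to the chosen point of its cell. The
  discrete sets are contained in the full ones, so the other half of each Hausdorff distance is 0.
\<close>

section \<open>The ball and the Urysohn operator\<close>

lemma Lp_ball_iff:
  assumes "p > 0" "r \<ge> 0"
  shows "x \<in> Lp_ball p r \<Omega> \<longleftrightarrow>
    x \<in> Lp_space p \<Omega> \<and> (LINT s|lebesgue_on \<Omega>. norm (x s) powr p) \<le> r powr p"
proof -
  let ?I = "LINT s|lebesgue_on \<Omega>. norm (x s) powr p"
  have "?I \<ge> 0" by (simp add: Bochner_Integration.integral_nonneg)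
  then have "?I powr (1 / p) \<le> r \<longleftrightarrow> ?I \<le> r powr p"
    using assms powr_mono2 [of p "?I powr (1 / p)" r] powr_mono2 [of "1 / p" ?I "r powr p"]
    by (auto simp: powr_powr)
  then show ?thesis by (auto simp: Lp_ball_def Lp_norm_def)
qed

text \<open>The elementary inequality \<open>t \<le> 1 + t\<^sup>p\<close> replaces Hoelder's inequality: any bound that is uniform
  over the ball suffices below.\<close>

lemma Lp_ball_integral_norm_le:
  assumes "compact \<Omega>" "p > 1" "r \<ge> 0" and x: "x \<in> Lp_ball p r \<Omega>"
  shows "integrable (lebesgue_on \<Omega>) (\<lambda>s. norm (x s))"
    and "(LINT s|lebesgue_on \<Omega>. norm (x s)) \<le> measure lebesgue \<Omega> + r powr p"
proof -
  have ms: "\<Omega> \<in> lmeasurable" "\<Omega> \<in> sets lebesgue"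
    using assms(1) lmeasurable_compact fmeasurableD by blast+
  interpret finite_measure "lebesgue_on \<Omega>"
    using ms by (intro finite_measure_lebesgue_on)
  have xm: "x \<in> borel_measurable (lebesgue_on \<Omega>)"
    and xi: "integrable (lebesgue_on \<Omega>) (\<lambda>s. norm (x s) powr p)"
    and xr: "(LINT s|lebesgue_on \<Omega>. norm (x s) powr p) \<le> r powr p"
    using x assms by (auto simp: Lp_ball_iff Lp_space_def)
  have t: "t \<le> 1 + t powr p" if "t \<ge> 0" for t :: real
  proof (cases "t \<le> 1")
    case True
    moreover have "0 \<le> t powr p" by simp
    ultimately show ?thesis by linarith
  next
    case False
    then have "t powr 1 \<le> t powr p" using assms by (intro powr_mono) auto
    then show ?thesis using False by simp
  qed
  have i1: "integrable (lebesgue_on \<Omega>) (\<lambda>s. 1 + norm (x s) powr p)"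
    using xi by simp
  show i: "integrable (lebesgue_on \<Omega>) (\<lambda>s. norm (x s))"
    by (rule Bochner_Integration.integrable_bound [OF i1]) (use xm t in auto)
  have "(LINT s|lebesgue_on \<Omega>. norm (x s)) \<le> (LINT s|lebesgue_on \<Omega>. 1 + norm (x s) powr p)"
    by (intro integral_mono i i1 t) auto
  also have "\<dots> = measure lebesgue \<Omega> + (LINT s|lebesgue_on \<Omega>. norm (x s) powr p)"
    using xi ms by (simp add: measure_restrict_space)
  finally show "(LINT s|lebesgue_on \<Omega>. norm (x s)) \<le> measure lebesgue \<Omega> + r powr p"
    using xr by linarith
qed

lemma urysohn_lipschitz:
  assumes "compact \<Omega>" "p > 1" "kernel_continuous E \<Omega> K" "kernel_lipschitz E \<Omega> K"
  obtains l where "l > 0" "\<And>x y \<xi>. \<lbrakk>x \<in> Lp_space p \<Omega>; y \<in> Lp_space p \<Omega>; \<xi> \<in> E\<rbrakk> \<Longrightarrow>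
    norm (urysohn E \<Omega> K x \<xi> - urysohn E \<Omega> K y \<xi>) \<le> l * (LINT s|lebesgue_on \<Omega>. norm (x s - y s))"
proof -
  obtain l where l: "l > 0"
      "\<And>\<xi> s a b. \<lbrakk>\<xi> \<in> E; s \<in> \<Omega>\<rbrakk> \<Longrightarrow> norm (K \<xi> s a - K \<xi> s b) \<le> l * norm (a - b)"
    using assms(4) unfolding kernel_lipschitz_def by metis
  have "norm (urysohn E \<Omega> K x \<xi> - urysohn E \<Omega> K y \<xi>) \<le> l * (LINT s|lebesgue_on \<Omega>. norm (x s - y s))"
    if x: "x \<in> Lp_space p \<Omega>" and y: "y \<in> Lp_space p \<Omega>" and \<xi>: "\<xi> \<in> E" for x y \<xi>
  proof -
    note ix = urysohn_integrable [OF assms x \<xi>]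
    note iy = urysohn_integrable [OF assms y \<xi>]
    have xm: "x \<in> borel_measurable (lebesgue_on \<Omega>)" "y \<in> borel_measurable (lebesgue_on \<Omega>)"
      using x y by (auto simp: Lp_space_def)
    have id: "integrable (lebesgue_on \<Omega>) (\<lambda>s. l * norm (x s - y s))"
      using ix(1) iy(1) xm by (simp add: integrable_norm_iff)
    have "norm (urysohn E \<Omega> K x \<xi> - urysohn E \<Omega> K y \<xi>)
        = norm (LINT s|lebesgue_on \<Omega>. K \<xi> s (x s) - K \<xi> s (y s))"
      using \<xi> ix(2) iy(2) by (simp add: urysohn_def)
    also have "\<dots> \<le> (LINT s|lebesgue_on \<Omega>. norm (K \<xi> s (x s) - K \<xi> s (y s)))"
      by (rule integral_norm_bound)
    also have "\<dots> \<le> (LINT s|lebesgue_on \<Omega>. l * norm (x s - y s))"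
      using ix(2) iy(2) id l(2) \<xi> by (intro integral_mono) auto
    finally show ?thesis by simp
  qed
  with l(1) show thesis by (rule that)
qed

text \<open>Compare with the image of the zero function, which is bounded because \<open>K(\<xi>, s, 0)\<close> is continuous on
  the compact set \<open>E \<times> \<Omega>\<close>.\<close>

lemma urysohn_image_bounded:
  assumes "compact E" "compact \<Omega>" "p > 1" "r \<ge> 0"
    "kernel_continuous E \<Omega> K" "kernel_lipschitz E \<Omega> K"
  obtains C where "\<And>y \<xi>. \<lbrakk>y \<in> urysohn_image E \<Omega> K p r; \<xi> \<in> E\<rbrakk> \<Longrightarrow> norm (y \<xi>) \<le> C"
proof -
  have ms: "\<Omega> \<in> lmeasurable"
    using assms(2) lmeasurable_compact by blast
  obtain l where l: "l > 0"
    and L: "\<And>x y \<xi>. \<lbrakk>x \<in> Lp_space p \<Omega>; y \<in> Lp_space p \<Omega>; \<xi> \<in> E\<rbrakk> \<Longrightarrow>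
      norm (urysohn E \<Omega> K x \<xi> - urysohn E \<Omega> K y \<xi>) \<le> l * (LINT s|lebesgue_on \<Omega>. norm (x s - y s))"
    by (rule urysohn_lipschitz [OF assms(2,3,5,6)]) (rule that; blast)
  have 0: "(\<lambda>s. 0) \<in> Lp_space p \<Omega>"
    by (simp add: Lp_space_def)
  have "continuous_on (E \<times> \<Omega>) ((\<lambda>(\<xi>, s, x). K \<xi> s x) \<circ> (\<lambda>z. (fst z, snd z, 0)))"
    using assms(5) unfolding kernel_continuous_def
    by (intro continuous_on_compose continuous_intros) (auto elim!: continuous_on_subset)
  then have "bounded ((\<lambda>z. K (fst z) (snd z) 0) ` (E \<times> \<Omega>))"
    using assms by (intro compact_imp_bounded compact_continuous_image compact_Times)
      (auto simp: o_def case_prod_unfold)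
  then obtain k where k: "\<And>\<xi> s. \<lbrakk>\<xi> \<in> E; s \<in> \<Omega>\<rbrakk> \<Longrightarrow> norm (K \<xi> s 0) \<le> k"
    by (force simp: bounded_iff)
  interpret finite_measure "lebesgue_on \<Omega>"
    using ms by (intro finite_measure_lebesgue_on)
  let ?C = "k * measure lebesgue \<Omega> + l * (measure lebesgue \<Omega> + r powr p)"
  have "norm (y \<xi>) \<le> ?C" if y: "y \<in> urysohn_image E \<Omega> K p r" and \<xi>: "\<xi> \<in> E" for y \<xi>
  proof -
    obtain x where x: "x \<in> Lp_ball p r \<Omega>" and y: "y = urysohn E \<Omega> K x"
      using y by (auto simp: urysohn_image_def)
    have "norm (urysohn E \<Omega> K (\<lambda>s. 0) \<xi>) \<le> (LINT s|lebesgue_on \<Omega>. norm (K \<xi> s 0))"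
      using \<xi> by (simp add: urysohn_def integral_norm_bound)
    also have "\<dots> \<le> (LINT s|lebesgue_on \<Omega>. k)"
      using urysohn_integrable(2) [OF assms(2,3,5,6) 0 \<xi>] k \<xi> by (intro integral_mono) auto
    also have "\<dots> = k * measure lebesgue \<Omega>"
      using ms by (simp add: measure_restrict_space)
    finally have "norm (urysohn E \<Omega> K (\<lambda>s. 0) \<xi>) \<le> k * measure lebesgue \<Omega>" .
    moreover have "norm (y \<xi> - urysohn E \<Omega> K (\<lambda>s. 0) \<xi>) \<le> l * (LINT s|lebesgue_on \<Omega>. norm (x s))"
      using L [OF _ 0 \<xi>, of x] x y by (simp add: Lp_ball_def)
    moreover have "\<dots> \<le> l * (measure lebesgue \<Omega> + r powr p)"
      using Lp_ball_integral_norm_le(2) [OF assms(2-4) x] l by simp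
    ultimately show ?thesis
      using norm_triangle_sub [of "y \<xi>" "urysohn E \<Omega> K (\<lambda>s. 0) \<xi>"] by linarith
  qed
  then show thesis by (rule that)
qed

text \<open>Integrating the modulus condition gives \<open>\<parallel>y(a) - y(b)\<parallel> \<le> c \<phi>(\<parallel>a - b\<parallel>)\<close> with the same constant \<open>c\<close> for
  every \<open>y\<close> in the image, since the weight \<open>\<omega>\<close> grows at most linearly and the \<open>L\<^sub>1\<close> norm is bounded on
  the ball.\<close>

lemma urysohn_image_equicontinuous:
  fixes K :: "'b::euclidean_space \<Rightarrow> 'k::euclidean_space \<Rightarrow> 'm::euclidean_space \<Rightarrow> 'n::euclidean_space"
  assumes "compact \<Omega>" "p > 1" "r \<ge> 0"
    "kernel_continuous E \<Omega> K" "kernel_lipschitz E \<Omega> K" "kernel_modulus E \<Omega> K" and e: "e > 0"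
  obtains d where "d > 0" "\<And>y a b. \<lbrakk>y \<in> urysohn_image E \<Omega> K p r; a \<in> E; b \<in> E; norm (a - b) < d\<rbrakk> \<Longrightarrow>
    norm (y a - y b) < e"
proof -
  have ms: "\<Omega> \<in> lmeasurable"
    using assms(1) lmeasurable_compact by blast
  interpret finite_measure "lebesgue_on \<Omega>"
    using ms by (intro finite_measure_lebesgue_on)
  obtain \<omega> :: "'k \<Rightarrow> 'm \<Rightarrow> real" and \<phi> :: "real \<Rightarrow> real" and \<beta>0 \<beta>1
    where b: "\<beta>0 \<ge> 0" "\<beta>1 \<ge> 0"
      and om: "\<And>s z. s \<in> \<Omega> \<Longrightarrow> \<omega> s z \<le> \<beta>0 * norm z + \<beta>1"
      and ph: "\<And>\<tau>. \<tau> \<ge> 0 \<Longrightarrow> 0 \<le> \<phi> \<tau>" "\<phi> 0 = 0" "(\<phi> \<longlongrightarrow> 0) (at_right 0)"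
      and K: "\<And>\<xi>1 \<xi>2 s z. \<xi>1 \<in> E \<Longrightarrow> \<xi>2 \<in> E \<Longrightarrow> s \<in> \<Omega> \<Longrightarrow>
          norm (K \<xi>1 s z - K \<xi>2 s z) \<le> \<omega> s z * \<phi> (norm (\<xi>1 - \<xi>2))"
    using assms(6) unfolding kernel_modulus_def by metis
  define c where "c = \<beta>0 * (measure lebesgue \<Omega> + r powr p) + \<beta>1 * measure lebesgue \<Omega>"
  have c: "c \<ge> 0" using b by (simp add: c_def)
  have diff: "norm (y a - y b) \<le> c * \<phi> (norm (a - b))"
    if y: "y \<in> urysohn_image E \<Omega> K p r" and "a \<in> E" "b \<in> E" for y a b
  proof -
    obtain x where x: "x \<in> Lp_ball p r \<Omega>" and y: "y = urysohn E \<Omega> K x"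
      using y by (auto simp: urysohn_image_def)
    have xs: "x \<in> Lp_space p \<Omega>" using x by (simp add: Lp_ball_def)
    note ix = Lp_ball_integral_norm_le [OF assms(1-3) x]
    note int = urysohn_integrable(2) [OF assms(1,2,4,5) xs]
    have "norm (y a - y b) = norm (LINT s|lebesgue_on \<Omega>. K a s (x s) - K b s (x s))"
      using that int by (simp add: y urysohn_def)
    also have "\<dots> \<le> (LINT s|lebesgue_on \<Omega>. norm (K a s (x s) - K b s (x s)))"
      by (rule integral_norm_bound)
    also have "\<dots> \<le> (LINT s|lebesgue_on \<Omega>. (\<beta>0 * norm (x s) + \<beta>1) * \<phi> (norm (a - b)))"
    proof (rule integral_mono)
      fix s assume "s \<in> space (lebesgue_on \<Omega>)"
      then have s: "s \<in> \<Omega>" by simp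
      show "norm (K a s (x s) - K b s (x s)) \<le> (\<beta>0 * norm (x s) + \<beta>1) * \<phi> (norm (a - b))"
        using K [OF that(2,3) s, of "x s"]
          mult_right_mono [OF om [OF s, of "x s"] ph(1) [of "norm (a - b)"]]
        by simp
    qed (use int ix(1) that in auto)
    also have "\<dots> = (\<beta>0 * (LINT s|lebesgue_on \<Omega>. norm (x s)) + \<beta>1 * measure lebesgue \<Omega>) * \<phi> (norm (a - b))"
      using ix(1) ms by (simp add: measure_restrict_space)
    also have "\<dots> \<le> c * \<phi> (norm (a - b))"
      unfolding c_def using b ph(1) ix(2) by (intro mult_right_mono add_mono mult_left_mono) auto
    finally show ?thesis .
  qed
  have "((\<lambda>t. c * \<phi> t) \<longlongrightarrow> 0) (at_right 0)"
    using ph(3) by (rule tendsto_mult_right_zero)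
  then have "\<forall>\<^sub>F t in at_right 0. c * \<phi> t < e"
    using e by (auto dest: order_tendstoD)
  then obtain d where d: "d > 0" "\<And>t. 0 < t \<Longrightarrow> t < d \<Longrightarrow> c * \<phi> t < e"
    by (auto simp: eventually_at_right_field)
  have "norm (y a - y b) < e"
    if "y \<in> urysohn_image E \<Omega> K p r" "a \<in> E" "b \<in> E" "norm (a - b) < d" for y a b
    using diff [OF that(1-3)] d(2) [of "norm (a - b)"] that(4) e by (cases "a = b") auto
  with d(1) show thesis by (rule that)
qed

section \<open>Total boundedness in the space of continuous functions\<close>

text \<open>By Arzela--Ascoli each sequence in \<open>F\<close> has a uniformly convergent, hence Cauchy, subsequence. The
  limit may lie outside \<open>F\<close>, which is why the conclusion is total boundedness rather than
  compactness.\<close>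

lemma equicontinuous_imp_mtotally_bounded:
  fixes F :: "('a::euclidean_space \<Rightarrow> 'b::euclidean_space) set"
  assumes E: "compact E" and F: "F \<subseteq> mspace (C_space E)"
    and bdd: "\<And>f x. \<lbrakk>f \<in> F; x \<in> E\<rbrakk> \<Longrightarrow> norm (f x) \<le> C"
    and equi: "\<And>e. e > 0 \<Longrightarrow>
      \<exists>d>0. \<forall>f\<in>F. \<forall>x\<in>E. \<forall>y\<in>E. norm (x - y) < d \<longrightarrow> norm (f x - f y) < e"
  shows "Metric_space.mtotally_bounded (mspace (C_space E)) (mdist (C_space E)) F"
proof -
  interpret M: Metric_space "mspace (C_space E)" "mdist (C_space E)"
    by (rule Metric_space_mspace_mdist)
  have "\<exists>k. strict_mono k \<and> M.MCauchy (\<sigma> \<circ> k)" if \<sigma>: "range \<sigma> \<subseteq> F" for \<sigma> :: "nat \<Rightarrow> 'a \<Rightarrow> 'b"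
  proof -
    have *: "\<And>n x. x \<in> E \<Longrightarrow> norm (\<sigma> n x) \<le> C"
      using \<sigma> bdd by blast
    have **: "\<exists>d>0. \<forall>n y. y \<in> E \<and> norm (x - y) < d \<longrightarrow> norm (\<sigma> n x - \<sigma> n y) < e"
      if "x \<in> E" "e > 0" for x e
      using equi [OF that(2)] that(1) \<sigma> by (meson range_subsetD)
    obtain g k where k: "strict_mono (k :: nat \<Rightarrow> nat)"
      and g: "\<And>e. 0 < e \<Longrightarrow> \<exists>N. \<forall>n x. n \<ge> N \<and> x \<in> E \<longrightarrow> norm (\<sigma> (k n) x - g x) < e"
      using Arzela_Ascoli [OF E * **] by metis
    have "M.MCauchy (\<sigma> \<circ> k)"
      unfolding M.MCauchy_def
    proof (intro conjI allI impI)
      show "range (\<sigma> \<circ> k) \<subseteq> mspace (C_space E)"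
        using \<sigma> F by (auto simp del: mspace_cfunspace)
      fix e :: real assume e: "e > 0"
      obtain N where N: "\<And>n x. n \<ge> N \<Longrightarrow> x \<in> E \<Longrightarrow> norm (\<sigma> (k n) x - g x) < e / 4"
        using g [of "e / 4"] e by auto
      have "mdist (C_space E) ((\<sigma> \<circ> k) m) ((\<sigma> \<circ> k) n) < e" if "m \<ge> N" "n \<ge> N" for m n
      proof -
        have "mdist (C_space E) ((\<sigma> \<circ> k) m) ((\<sigma> \<circ> k) n) \<le> e / 2"
        proof (rule mdist_cfunspace_le)
          fix x assume "x \<in> topspace (top_of_set E)"
          then have "x \<in> E" by simp
          then show "mdist euclidean_metric ((\<sigma> \<circ> k) m x) ((\<sigma> \<circ> k) n x) \<le> e / 2"
            using norm_diff_triangle_le [of "\<sigma> (k m) x" "g x" "e / 4" "\<sigma> (k n) x" "e / 4"]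
              N [OF that(1)] N [OF that(2)] by (simp add: dist_norm norm_minus_commute less_imp_le)
        qed (use e in auto)
        then show ?thesis using e by linarith
      qed
      then show "\<exists>N. \<forall>n n'. N \<le> n \<longrightarrow> N \<le> n' \<longrightarrow> mdist (C_space E) ((\<sigma> \<circ> k) n) ((\<sigma> \<circ> k) n') < e"
        by blast
    qed
    with k show ?thesis by blast
  qed
  then show ?thesis
    using F by (simp add: M.mtotally_bounded_sequentially del: mspace_cfunspace)
qed

section \<open>Continuous functions inside the ball\<close>

text \<open>The metric projection onto a ball serves as truncation: it is continuous, bounded, and never
  increases the norm.\<close>

lemma norm_closest_point_cball_le:
  fixes v :: "'a::euclidean_space"
  assumes "B \<ge> 0"
  shows "norm (closest_point (cball 0 B) v) \<le> norm v" "norm (closest_point (cball 0 B) v) \<le> B"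
proof -
  have "closest_point (cball 0 B) (0::'a) = 0"
    using assms by (intro closest_point_self) auto
  then show "norm (closest_point (cball 0 B) v) \<le> norm v"
    using closest_point_lipschitz [of "cball 0 B" v 0] assms by (auto simp: dist_norm)
  show "norm (closest_point (cball 0 B) v) \<le> B"
    using closest_point_in_set [of "cball 0 B" v] assms by auto
qed

lemma continuous_on_closest_point_cball:
  fixes B :: real
  assumes "B \<ge> 0"
  shows "continuous_on UNIV (closest_point (cball (0::'a::euclidean_space) B))"
  using assms by (intro continuous_on_closest_point) auto

text \<open>Truncation alone would only keep the norm at most \<open>r\<close>. Shrinking by a factor less than 1 as well
  makes it strictly smaller, which leaves room for the later approximation by continuous functions.\<close>

lemma Lp_ball_approx_bounded:
  fixes x :: "'k::euclidean_space \<Rightarrow> 'm::euclidean_space"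
  assumes "compact \<Omega>" "p > 1" "r > 0" and x: "x \<in> Lp_ball p r \<Omega>" and "\<eta> > 0"
  obtains B y where "B \<ge> 0" "y \<in> borel_measurable (lebesgue_on \<Omega>)" "\<And>s. norm (y s) \<le> B"
    "(LINT s|lebesgue_on \<Omega>. norm (y s) powr p) < r powr p"
    "(LINT s|lebesgue_on \<Omega>. norm (x s - y s)) < \<eta>"
proof -
  have xm: "x \<in> borel_measurable (lebesgue_on \<Omega>)"
    and xi: "integrable (lebesgue_on \<Omega>) (\<lambda>s. norm (x s) powr p)"
    and xr: "(LINT s|lebesgue_on \<Omega>. norm (x s) powr p) \<le> r powr p"
    using x assms by (auto simp: Lp_ball_iff Lp_space_def)
  \<comment> \<open>Shrink by \<open>c n < 1\<close> and truncate at radius \<open>n\<close>; the case \<open>n = 0\<close> is harmless, as \<open>c 0 = 0\<close>.\<close>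
  define c where "c n = 1 - 1 / real (Suc n)" for n
  have c: "0 \<le> c n" "c n < 1" for n by (auto simp: c_def)
  define y where "y n s = c n *\<^sub>R closest_point (cball 0 (real n)) (x s)" for n s
  have ym: "y n \<in> borel_measurable (lebesgue_on \<Omega>)" for n
    unfolding y_def using xm
    by (intro borel_measurable_scaleR borel_measurable_const measurable_compose [OF xm]
        borel_measurable_continuous_onI continuous_on_closest_point_cball) auto
  have yx: "norm (y n s) \<le> c n * norm (x s)" for n s
    using norm_closest_point_cball_le(1) [of "real n" "x s"] c by (auto simp: y_def intro!: mult_left_mono)
  have yx1: "norm (y n s) \<le> norm (x s)" for n s
    using yx [of n s] mult_right_mono [of "c n" 1 "norm (x s)"] c [of n] by simp
  have yn: "norm (y n s) \<le> real n" for n s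
    using norm_closest_point_cball_le(2) [of "real n" "x s"] c [of n]
      mult_mono [of "c n" 1 "norm (closest_point (cball 0 (real n)) (x s))" "real n"]
    by (simp add: y_def)
  have lim: "(\<lambda>n. norm (x s - y n s)) \<longlonglongrightarrow> 0" for s
  proof -
    have "\<forall>\<^sub>F n in sequentially. norm (x s) \<le> real n"
      using filterlim_real_sequentially by (auto simp: filterlim_at_top)
    then have "\<forall>\<^sub>F n in sequentially. c n *\<^sub>R x s = y n s"
      by eventually_elim (simp add: y_def closest_point_self)
    moreover have "c \<longlonglongrightarrow> 1 - 0"
      unfolding c_def by (intro tendsto_diff tendsto_const LIMSEQ_Suc lim_1_over_n)
    then have "(\<lambda>n. c n *\<^sub>R x s) \<longlonglongrightarrow> 1 *\<^sub>R x s"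
      by (intro tendsto_intros) auto
    ultimately have "(\<lambda>n. y n s) \<longlonglongrightarrow> x s"
      by (auto intro: Lim_transform_eventually)
    then have "(\<lambda>n. x s - y n s) \<longlonglongrightarrow> x s - x s"
      by (intro tendsto_intros)
    then show ?thesis by (simp add: tendsto_norm_zero)
  qed
  have "(\<lambda>n. LINT s|lebesgue_on \<Omega>. norm (x s - y n s)) \<longlonglongrightarrow> (LINT s|lebesgue_on \<Omega>. 0)"
  proof (rule integral_dominated_convergence [where w = "\<lambda>s. 2 * norm (x s)"])
    show "integrable (lebesgue_on \<Omega>) (\<lambda>s. 2 * norm (x s))"
      using Lp_ball_integral_norm_le(1) [OF assms(1,2) _ x] assms by simp
    show "AE s in lebesgue_on \<Omega>. norm (norm (x s - y n s)) \<le> 2 * norm (x s)" for n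
      by (intro AE_I2) (smt (verit) norm_triangle_ineq4 yx1 real_norm_def norm_ge_zero)
  qed (use xm ym lim in auto)
  then have "\<forall>\<^sub>F n in sequentially. (LINT s|lebesgue_on \<Omega>. norm (x s - y n s)) < \<eta>"
    using assms by (auto dest: order_tendstoD)
  then obtain n where n: "(LINT s|lebesgue_on \<Omega>. norm (x s - y n s)) < \<eta>"
    by (auto simp: eventually_sequentially)
  have pn: "norm (y n s) powr p \<le> c n powr p * norm (x s) powr p" for s
    using powr_mono2 [OF _ _ yx [of n s], of p] assms c [of n] by (simp add: powr_mult)
  have iy: "integrable (lebesgue_on \<Omega>) (\<lambda>s. norm (y n s) powr p)"
  proof (rule Bochner_Integration.integrable_bound)
    show "integrable (lebesgue_on \<Omega>) (\<lambda>s. c n powr p * norm (x s) powr p)"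
      using xi by simp
  qed (use ym pn in auto)
  have "(LINT s|lebesgue_on \<Omega>. norm (y n s) powr p)
      \<le> (LINT s|lebesgue_on \<Omega>. c n powr p * norm (x s) powr p)"
    using pn xi iy by (intro integral_mono) auto
  also have "\<dots> \<le> c n powr p * r powr p"
    using xr by (simp add: mult_left_mono)
  also have "\<dots> < r powr p"
    using c [of n] assms powr_less_mono2 [of p "c n" 1] by simp
  finally show thesis
    using that [of "real n" "y n"] ym yn n by simp
qed

text \<open>The bounded function \<open>y\<close> of the previous lemma is an almost everywhere limit of continuous functions.
  Truncated at the bound of \<open>y\<close> these are dominated by a constant, so both the \<open>L\<^sub>1\<close> distance to \<open>y\<close>
  and the \<open>p\<close>-th power integrals converge. Since the limit of the latter is strictly below \<open>r\<^sup>p\<close>,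
  late members of the sequence lie in the ball.\<close>

lemma Lp_ball_approx_continuous:
  fixes x :: "'k::euclidean_space \<Rightarrow> 'm::euclidean_space"
  assumes "compact \<Omega>" "p > 1" "r > 0" and x: "x \<in> Lp_ball p r \<Omega>" and "\<eta> > 0"
  obtains g where "continuous_on UNIV g" "g \<in> Lp_ball p r \<Omega>"
    "(LINT s|lebesgue_on \<Omega>. norm (x s - g s)) < \<eta>"
proof -
  have ms: "\<Omega> \<in> lmeasurable" "\<Omega> \<in> sets lebesgue"
    using assms(1) lmeasurable_compact fmeasurableD by blast+
  interpret finite_measure "lebesgue_on \<Omega>"
    using ms by (intro finite_measure_lebesgue_on)
  obtain B y where B: "B \<ge> 0" and ym: "y \<in> borel_measurable (lebesgue_on \<Omega>)"
    and yB: "\<And>s. norm (y s) \<le> B"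
    and yr: "(LINT s|lebesgue_on \<Omega>. norm (y s) powr p) < r powr p"
    and xy: "(LINT s|lebesgue_on \<Omega>. norm (x s - y s)) < \<eta> / 2"
    using Lp_ball_approx_bounded [OF assms(1-4), of "\<eta> / 2"] assms(5) by auto
  obtain N G where N: "negligible N" and G: "\<And>n. continuous_on UNIV (G n)"
    and lim: "\<And>s. s \<notin> N \<Longrightarrow> (\<lambda>n. G n s) \<longlonglongrightarrow> (if s \<in> \<Omega> then y s else 0)"
    using ym measurable_on_iff_borel_measurable [OF ms(2)] unfolding measurable_on_def by metis
  define g where "g n = closest_point (cball 0 B) \<circ> G n" for n
  have g: "continuous_on UNIV (g n)" for n
    unfolding g_def using G continuous_on_closest_point_cball [OF B]
    by (intro continuous_on_compose) (auto elim: continuous_on_subset)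
  have gm: "g n \<in> borel_measurable (lebesgue_on \<Omega>)" for n
    using ms(2) by (intro continuous_imp_measurable_on_sets_lebesgue continuous_on_subset [OF g]) auto
  have gB: "norm (g n s) \<le> B" for n s
    using norm_closest_point_cball_le(2) [OF B] by (simp add: g_def)
  have glim: "(\<lambda>n. g n s) \<longlonglongrightarrow> y s" if "s \<in> \<Omega>" "s \<notin> N" for s
  proof -
    have "isCont (closest_point (cball 0 B)) (y s)"
      using continuous_on_closest_point_cball [OF B, where 'a = 'm]
      by (simp add: continuous_on_eq_continuous_at)
    then have "(\<lambda>n. closest_point (cball 0 B) (G n s)) \<longlonglongrightarrow> closest_point (cball 0 B) (y s)"
      by (rule isCont_tendsto_compose) (use lim [OF that(2)] that(1) in simp)
    then show ?thesis
      using yB [of s] by (simp add: g_def closest_point_self)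
  qed
  have "AE s in lebesgue_on \<Omega>. s \<notin> N"
    using N ms by (auto simp: AE_restrict_space_iff negligible_iff_null_sets dest: AE_not_in)
  then have ae: "AE s in lebesgue_on \<Omega>. (\<lambda>n. g n s) \<longlonglongrightarrow> y s"
    using AE_space by eventually_elim (use glim in auto)
  have "(\<lambda>n. LINT s|lebesgue_on \<Omega>. norm (y s - g n s)) \<longlonglongrightarrow> (LINT s|lebesgue_on \<Omega>. 0)"
  proof (rule integral_dominated_convergence [where w = "\<lambda>s. 2 * B"])
    show "AE s in lebesgue_on \<Omega>. norm (norm (y s - g n s)) \<le> 2 * B" for n
      by (intro AE_I2) (smt (verit) norm_triangle_ineq4 yB gB real_norm_def norm_ge_zero)
    show "AE s in lebesgue_on \<Omega>. (\<lambda>n. norm (y s - g n s)) \<longlonglongrightarrow> 0"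
      using ae by eventually_elim (auto intro!: tendsto_eq_intros)
  qed (use gm ym in auto)
  then have e1: "\<forall>\<^sub>F n in sequentially. (LINT s|lebesgue_on \<Omega>. norm (y s - g n s)) < \<eta> / 2"
    by (rule order_tendstoD(2)) (use \<open>\<eta> > 0\<close> in simp)
  have "(\<lambda>n. LINT s|lebesgue_on \<Omega>. norm (g n s) powr p) \<longlonglongrightarrow> (LINT s|lebesgue_on \<Omega>. norm (y s) powr p)"
  proof (rule integral_dominated_convergence [where w = "\<lambda>s. B powr p"])
    show "AE s in lebesgue_on \<Omega>. norm (norm (g n s) powr p) \<le> B powr p" for n
      using gB assms by (intro AE_I2) (auto intro: powr_mono2)
    show "AE s in lebesgue_on \<Omega>. (\<lambda>n. norm (g n s) powr p) \<longlonglongrightarrow> norm (y s) powr p"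
      using ae by eventually_elim (use assms in \<open>auto intro!: tendsto_powr' tendsto_norm\<close>)
  qed (use gm ym in auto)
  then have e2: "\<forall>\<^sub>F n in sequentially. (LINT s|lebesgue_on \<Omega>. norm (g n s) powr p) < r powr p"
    using yr by (auto dest: order_tendstoD)
  obtain n where n: "(LINT s|lebesgue_on \<Omega>. norm (y s - g n s)) < \<eta> / 2"
      "(LINT s|lebesgue_on \<Omega>. norm (g n s) powr p) < r powr p"
    using eventually_conj [OF e1 e2] by (auto simp: eventually_sequentially)
  have ig: "integrable (lebesgue_on \<Omega>) (\<lambda>s. norm (g n s) powr p)"
    by (rule integrable_const_bound [where B = "B powr p"])
      (use gm gB assms in \<open>auto intro!: powr_mono2 AE_I2\<close>)
  have xm: "x \<in> borel_measurable (lebesgue_on \<Omega>)"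
    using x by (simp add: Lp_ball_def Lp_space_def)
  have ix: "integrable (lebesgue_on \<Omega>) x"
    using Lp_ball_integral_norm_le(1) [OF assms(1,2) _ x] assms xm by (simp add: integrable_norm_iff)
  have iyg: "integrable (lebesgue_on \<Omega>) y" "integrable (lebesgue_on \<Omega>) (g n)"
    by (rule integrable_const_bound [where B = B]; use ym gm yB gB in auto)+
  have "(LINT s|lebesgue_on \<Omega>. norm (x s - g n s))
      \<le> (LINT s|lebesgue_on \<Omega>. norm (x s - y s) + norm (y s - g n s))"
    using ix iyg by (intro integral_mono) (auto intro: norm_diff_triangle_le)
  also have "\<dots> = (LINT s|lebesgue_on \<Omega>. norm (x s - y s)) + (LINT s|lebesgue_on \<Omega>. norm (y s - g n s))"
    using ix iyg by simp
  finally have "(LINT s|lebesgue_on \<Omega>. norm (x s - g n s)) < \<eta>"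
    using xy n by linarith
  moreover have "g n \<in> Lp_ball p r \<Omega>"
    using assms n gm ig by (simp add: Lp_ball_iff Lp_space_def)
  ultimately show thesis
    using that g by blast
qed

section \<open>Rounding to the grid\<close>

text \<open>The direction of \<open>v\<close> is taken from the net, at the cost of \<open>\<gamma> \<sigma>\<close>, and its length is decreased by \<open>\<eta>\<close>
  and then rounded down to the grid. The safety margin \<open>\<eta>\<close> absorbs the oscillation of a function that
  takes the value \<open>v\<close> at one point of a cell.\<close>

lemma polar_grid_approx:
  fixes v :: "'a::euclidean_space"
  assumes w: "uniform_partition \<gamma> \<delta> q w" and "\<delta> > 0" "\<gamma> > 0" and S: "finite_net \<sigma> (sphere 0 1) S"
    and v: "norm v \<le> \<gamma>" and "\<eta> \<ge> 0" "\<sigma> \<ge> 0"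
  obtains l b where "l \<in> {0..q}" "b \<in> S" "norm (w l *\<^sub>R b) \<le> max 0 (norm v - \<eta>)"
    "norm (v - w l *\<^sub>R b) \<le> \<eta> + \<delta> + \<gamma> * \<sigma>"
proof -
  have wl: "w l = real l * \<delta>" if "l \<le> q" for l
    using that
  proof (induction l)
    case 0 then show ?case using w by (simp add: uniform_partition_def)
  next
    case (Suc l)
    have "w (Suc l) - w l = \<delta>" using w Suc.prems by (simp add: uniform_partition_def)
    then have "w (Suc l) = w l + \<delta>" by linarith
    then show ?case using Suc by (simp add: algebra_simps)
  qed
  have \<gamma>: "\<gamma> = real q * \<delta>"
    using wl [of q] w by (simp add: uniform_partition_def)
  define t where "t = max 0 (norm v - \<eta>)"
  define l where "l = nat \<lfloor>t / \<delta>\<rfloor>"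
  have t: "0 \<le> t" "t \<le> norm v" "norm v \<le> t + \<eta>"
    using assms by (auto simp: t_def)
  have l: "real l \<le> t / \<delta>" "t / \<delta> < real l + 1"
    using t \<open>\<delta> > 0\<close> by (auto simp: l_def)
  then have l': "real l * \<delta> \<le> t" "t < real l * \<delta> + \<delta>"
    using \<open>\<delta> > 0\<close> by (auto simp: field_simps)
  then have "real l * \<delta> \<le> real q * \<delta>"
    using t v \<gamma> by linarith
  then have lq: "l \<le> q" using \<open>\<delta> > 0\<close> by simp
  obtain u where u: "u \<in> sphere 0 1" "v = norm v *\<^sub>R u"
  proof (cases "v = 0")
    case True
    obtain u :: 'a where "norm u = 1" using vector_choose_size [of 1] by auto
    then show ?thesis using True that by auto
  next
    case False
    then show ?thesis using that [of "v /\<^sub>R norm v"] by simp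
  qed
  then obtain b where b: "b \<in> S" "norm (u - b) \<le> \<sigma>" "norm b = 1"
    using S unfolding finite_net_def by (metis dist_0_norm mem_sphere subsetD)
  have "v - w l *\<^sub>R b = norm v *\<^sub>R (u - b) + (norm v - w l) *\<^sub>R b"
    by (simp add: scaleR_diff_left scaleR_diff_right flip: u(2))
  then have "norm (v - w l *\<^sub>R b) \<le> norm v * norm (u - b) + \<bar>norm v - w l\<bar>"
    using b(3) norm_triangle_ineq [of "norm v *\<^sub>R (u - b)" "(norm v - w l) *\<^sub>R b"] by simp
  also have "\<dots> \<le> \<gamma> * \<sigma> + (\<eta> + \<delta>)"
    using b(2) v t l' lq \<open>\<gamma> > 0\<close> by (intro add_mono mult_mono) (auto simp: wl)
  finally have "norm (v - w l *\<^sub>R b) \<le> \<eta> + \<delta> + \<gamma> * \<sigma>" by simp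
  moreover have "norm (w l *\<^sub>R b) \<le> t"
    using lq b(3) l'(1) \<open>\<delta> > 0\<close> by (simp add: wl)
  ultimately show thesis
    using that [of l b] lq b(1) by (simp add: t_def)
qed

text \<open>On each cell the value of \<open>g\<close> at one sample point is rounded with a margin equal to the oscillation
  \<open>\<eta>\<close>. The constant so obtained is bounded in norm by \<open>\<parallel>g(s)\<parallel>\<close> for every \<open>s\<close> in the cell.\<close>

lemma discrete_Lp_ball_approx:
  fixes g :: "'k::euclidean_space \<Rightarrow> 'm::euclidean_space"
  assumes "p > 1" "r > 0" and g: "g \<in> Lp_ball p r \<Omega>" "\<And>s. s \<in> \<Omega> \<Longrightarrow> norm (g s) \<le> \<gamma>"
    and part: "finite_partition \<Delta> \<Omega> M \<Omega>s"
    and osc: "\<And>s t. \<lbrakk>s \<in> \<Omega>; t \<in> \<Omega>; dist s t \<le> \<Delta>\<rbrakk> \<Longrightarrow> norm (g s - g t) \<le> \<eta>"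
    and w: "uniform_partition \<gamma> \<delta> q w" "\<delta> > 0" "\<gamma> > 0"
    and S: "finite_net \<sigma> (sphere 0 1) S" "\<sigma> \<ge> 0" and \<eta>: "\<eta> \<ge> 0"
  obtains z where "z \<in> discrete_Lp_ball p r \<Omega> M \<Omega>s q w S"
    "\<And>s. s \<in> \<Omega> \<Longrightarrow> norm (g s - z s) \<le> 2 * \<eta> + \<delta> + \<gamma> * \<sigma>"
proof -
  have meas: "\<And>j. j \<in> {1..M} \<Longrightarrow> \<Omega>s j \<in> sets lebesgue" and sub: "\<And>j. j \<in> {1..M} \<Longrightarrow> \<Omega>s j \<subseteq> \<Omega>"
    and disj: "disjoint_family_on \<Omega>s {1..M}" and un: "\<Omega> = (\<Union>j\<in>{1..M}. \<Omega>s j)"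
    and diam: "\<And>j s t. \<lbrakk>j \<in> {1..M}; s \<in> \<Omega>s j; t \<in> \<Omega>s j\<rbrakk> \<Longrightarrow> dist s t \<le> \<Delta>"
    using part diameter_bounded_bound order_trans unfolding finite_partition_def by blast+
  have "\<exists>v. (\<exists>l\<in>{0..q}. \<exists>b\<in>S. v = w l *\<^sub>R b) \<and>
      (\<forall>s\<in>\<Omega>s j. norm v \<le> norm (g s) \<and> norm (g s - v) \<le> 2 * \<eta> + \<delta> + \<gamma> * \<sigma>)"
    if j: "j \<in> {1..M}" for j
  proof (cases "\<Omega>s j = {}")
    case True
    \<comment> \<open>An empty cell also needs a grid value; rounding 0 shows that the grid is nonempty.\<close>
    obtain l b where "l \<in> {0..q}" "b \<in> S"
      using polar_grid_approx [OF w S(1) _ \<eta> S(2), of 0] w(3) by (metis less_imp_le norm_zero)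
    then show ?thesis using True by (intro exI [of _ "w l *\<^sub>R b"]) blast
  next
    case False
    then obtain a where a: "a \<in> \<Omega>s j" by auto
    then have a\<Omega>: "a \<in> \<Omega>" using sub j by auto
    obtain l b where lb: "l \<in> {0..q}" "b \<in> S" "norm (w l *\<^sub>R b) \<le> max 0 (norm (g a) - \<eta>)"
        "norm (g a - w l *\<^sub>R b) \<le> \<eta> + \<delta> + \<gamma> * \<sigma>"
      using polar_grid_approx [OF w S(1) g(2) [OF a\<Omega>] \<eta> S(2)] by metis
    have "norm (w l *\<^sub>R b) \<le> norm (g s) \<and> norm (g s - w l *\<^sub>R b) \<le> 2 * \<eta> + \<delta> + \<gamma> * \<sigma>"
      if s: "s \<in> \<Omega>s j" for s
    proof
      have d: "norm (g s - g a) \<le> \<eta>"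
        using osc [of s a] diam [OF j s a] sub [OF j] s a\<Omega> by auto
      have "norm (g a) - \<eta> \<le> norm (g s)"
        using d norm_triangle_ineq3 [of "g s" "g a"] by linarith
      then show "norm (w l *\<^sub>R b) \<le> norm (g s)"
        using lb(3) norm_ge_zero [of "g s"] by linarith
      have "norm (g s - w l *\<^sub>R b) \<le> norm (g s - g a) + norm (g a - w l *\<^sub>R b)"
        by (rule norm_diff_triangle_le) auto
      then show "norm (g s - w l *\<^sub>R b) \<le> 2 * \<eta> + \<delta> + \<gamma> * \<sigma>"
        using d lb(4) by linarith
    qed
    then show ?thesis using lb(1,2) by blast
  qed
  then obtain v where v: "\<And>j. j \<in> {1..M} \<Longrightarrow> \<exists>l\<in>{0..q}. \<exists>b\<in>S. v j = w l *\<^sub>R b"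
    and vg: "\<And>j s. \<lbrakk>j \<in> {1..M}; s \<in> \<Omega>s j\<rbrakk> \<Longrightarrow> norm (v j) \<le> norm (g s)"
      "\<And>j s. \<lbrakk>j \<in> {1..M}; s \<in> \<Omega>s j\<rbrakk> \<Longrightarrow> norm (g s - v j) \<le> 2 * \<eta> + \<delta> + \<gamma> * \<sigma>"
    by metis
  define z where "z s = (\<Sum>j\<in>{1..M}. indicat_real (\<Omega>s j) s *\<^sub>R v j)" for s
  have zv: "z s = v j" if "j \<in> {1..M}" "s \<in> \<Omega>s j" for j s
  proof -
    have "indicat_real (\<Omega>s i) s *\<^sub>R v i = (if i = j then v j else 0)" if "i \<in> {1..M}" for i
    proof (cases "i = j")
      case False
      then have "s \<notin> \<Omega>s i"
        using disj that \<open>j \<in> {1..M}\<close> \<open>s \<in> \<Omega>s j\<close> unfolding disjoint_family_on_def by blast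
      then show ?thesis using False by simp
    qed (use \<open>s \<in> \<Omega>s j\<close> in simp)
    then have "z s = (\<Sum>i\<in>{1..M}. if i = j then v j else 0)"
      unfolding z_def by (intro sum.cong) auto
    then show ?thesis using that by simp
  qed
  have zg: "norm (z s) \<le> norm (g s)" "norm (g s - z s) \<le> 2 * \<eta> + \<delta> + \<gamma> * \<sigma>" if "s \<in> \<Omega>" for s
    using that un zv vg by (metis UN_E)+
  have zm: "z \<in> borel_measurable (lebesgue_on \<Omega>)"
    unfolding z_def
    by (intro borel_measurable_sum borel_measurable_scaleR borel_measurable_const
        measurable_restrict_space1 borel_measurable_indicator meas)
  have gi: "integrable (lebesgue_on \<Omega>) (\<lambda>s. norm (g s) powr p)"
    and gr: "(LINT s|lebesgue_on \<Omega>. norm (g s) powr p) \<le> r powr p"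
    using g(1) assms(1,2) by (auto simp: Lp_ball_iff Lp_space_def)
  have zp: "norm (z s) powr p \<le> norm (g s) powr p" if "s \<in> \<Omega>" for s
    using zg(1) [OF that] assms(1) by (intro powr_mono2) auto
  have zi: "integrable (lebesgue_on \<Omega>) (\<lambda>s. norm (z s) powr p)"
    by (rule Bochner_Integration.integrable_bound [OF gi]) (use zm zp in auto)
  have "(LINT s|lebesgue_on \<Omega>. norm (z s) powr p) \<le> (LINT s|lebesgue_on \<Omega>. norm (g s) powr p)"
    using zi gi zp by (intro integral_mono) auto
  then have "z \<in> Lp_ball p r \<Omega>"
    using gr zi zm assms(1,2) by (simp add: Lp_ball_iff Lp_space_def)
  moreover have "\<forall>j\<in>{1..M}. \<exists>l\<in>{0..q}. \<exists>b\<in>S. \<forall>s\<in>\<Omega>s j. z s = w l *\<^sub>R b"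
    using v zv by metis
  ultimately have "z \<in> discrete_Lp_ball p r \<Omega> M \<Omega>s q w S"
    by (simp add: discrete_Lp_ball_def)
  then show thesis using that zg(2) by blast
qed

section \<open>Discretization of the image and of the funnel\<close>

lemma hausdorff_distance_le:
  assumes "\<And>a. a \<in> A \<Longrightarrow> \<exists>b\<in>B. mdist m a b \<le> e" and "\<And>b. b \<in> B \<Longrightarrow> \<exists>a\<in>A. mdist m b a \<le> e"
  shows "hausdorff_distance m A B \<le> ennreal e"
  unfolding hausdorff_distance_def
proof (intro max.boundedI SUP_least)
  show "(INF b\<in>B. ennreal (mdist m a b)) \<le> ennreal e" if "a \<in> A" for a
    using assms(1) [OF that] by (meson INF_lower2 ennreal_leI)
  show "(INF a\<in>A. ennreal (mdist m b a)) \<le> ennreal e" if "b \<in> B" for b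
    using assms(2) [OF that] by (meson INF_lower2 ennreal_leI)
qed

text \<open>A finite net exists by total boundedness, and its members are perturbed to images of continuous
  functions using the Lipschitz estimate; half of \<open>e\<close> is spent on each step.\<close>

lemma urysohn_image_continuous_net:
  fixes K :: "'b::euclidean_space \<Rightarrow> 'k::euclidean_space \<Rightarrow> 'm::euclidean_space \<Rightarrow> 'n::euclidean_space"
  assumes "compact E" "compact \<Omega>" "p > 1" "r > 0"
    "kernel_continuous E \<Omega> K" "kernel_lipschitz E \<Omega> K" "kernel_modulus E \<Omega> K" and e: "e > 0"
  obtains G where "finite G" "\<And>g. g \<in> G \<Longrightarrow> continuous_on UNIV g \<and> g \<in> Lp_ball p r \<Omega>"
    "\<And>y. y \<in> urysohn_image E \<Omega> K p r \<Longrightarrow> \<exists>g\<in>G. \<forall>\<xi>\<in>E. norm (y \<xi> - urysohn E \<Omega> K g \<xi>) \<le> e"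
proof -
  interpret M: Metric_space "mspace (C_space E :: ('b \<Rightarrow> 'n) metric)" "mdist (C_space E)"
    by (rule Metric_space_mspace_mdist)
  note sub = urysohn_image_subset_cfunspace(2) [OF assms(1-3,5-7), of r]
  obtain C where C: "\<And>y \<xi>. \<lbrakk>y \<in> urysohn_image E \<Omega> K p r; \<xi> \<in> E\<rbrakk> \<Longrightarrow> norm (y \<xi>) \<le> C"
    by (rule urysohn_image_bounded [OF assms(1-3) less_imp_le [OF assms(4)] assms(5,6)]) (rule that; blast)
  have "M.mtotally_bounded (urysohn_image E \<Omega> K p r)"
  proof (rule equicontinuous_imp_mtotally_bounded [OF assms(1) sub, where C = C])
    fix e :: real assume "e > 0"
    obtain d where "d > 0" "\<And>y a b. \<lbrakk>y \<in> urysohn_image E \<Omega> K p r; a \<in> E; b \<in> E; norm (a - b) < d\<rbrakk> \<Longrightarrow>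
        norm (y a - y b) < e"
      by (rule urysohn_image_equicontinuous
          [OF assms(2,3) less_imp_le [OF assms(4)] assms(5-7) \<open>e > 0\<close>]) (rule that; blast)
    then show "\<exists>d>0. \<forall>y\<in>urysohn_image E \<Omega> K p r. \<forall>a\<in>E. \<forall>b\<in>E.
        norm (a - b) < d \<longrightarrow> norm (y a - y b) < e"
      by blast
  qed (rule C)
  from this [unfolded M.mtotally_bounded_def, rule_format, OF half_gt_zero [OF e]]
  obtain F where F: "finite F" "F \<subseteq> urysohn_image E \<Omega> K p r"
      "urysohn_image E \<Omega> K p r \<subseteq> (\<Union>f\<in>F. M.mball f (e / 2))"
    by blast
  obtain l where l: "l > 0"
    and L: "\<And>x y \<xi>. \<lbrakk>x \<in> Lp_space p \<Omega>; y \<in> Lp_space p \<Omega>; \<xi> \<in> E\<rbrakk> \<Longrightarrow>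
      norm (urysohn E \<Omega> K x \<xi> - urysohn E \<Omega> K y \<xi>) \<le> l * (LINT s|lebesgue_on \<Omega>. norm (x s - y s))"
    by (rule urysohn_lipschitz [OF assms(2,3,5,6)]) (rule that; blast)
  have "\<exists>g. continuous_on UNIV g \<and> g \<in> Lp_ball p r \<Omega> \<and>
      (\<forall>\<xi>\<in>E. norm (f \<xi> - urysohn E \<Omega> K g \<xi>) \<le> e / 2)" if fF: "f \<in> F" for f
  proof -
    obtain x where x: "x \<in> Lp_ball p r \<Omega>" and f: "f = urysohn E \<Omega> K x"
      using subsetD [OF F(2) fF] unfolding urysohn_image_def by blast
    obtain g where g: "continuous_on UNIV g" "g \<in> Lp_ball p r \<Omega>"
        "(LINT s|lebesgue_on \<Omega>. norm (x s - g s)) < e / (2 * l)"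
      using Lp_ball_approx_continuous [OF assms(2-4) x, of "e / (2 * l)"] e l by auto
    have "norm (f \<xi> - urysohn E \<Omega> K g \<xi>) \<le> e / 2" if "\<xi> \<in> E" for \<xi>
    proof -
      have "norm (f \<xi> - urysohn E \<Omega> K g \<xi>) \<le> l * (LINT s|lebesgue_on \<Omega>. norm (x s - g s))"
        using L [OF _ _ that] x g(2) by (simp add: f Lp_ball_def)
      also have "\<dots> \<le> l * (e / (2 * l))"
        using g(3) l by (intro mult_left_mono) auto
      finally show ?thesis using l by simp
    qed
    with g show ?thesis by blast
  qed
  then obtain h where h: "\<And>f. f \<in> F \<Longrightarrow> continuous_on UNIV (h f) \<and> h f \<in> Lp_ball p r \<Omega>"
      "\<And>f \<xi>. \<lbrakk>f \<in> F; \<xi> \<in> E\<rbrakk> \<Longrightarrow> norm (f \<xi> - urysohn E \<Omega> K (h f) \<xi>) \<le> e / 2"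
    by metis
  show thesis
  proof (rule that [of "h ` F"])
    fix y assume y: "y \<in> urysohn_image E \<Omega> K p r"
    then obtain f where f: "f \<in> F" "mdist (C_space E) f y < e / 2"
      using F(3) by (auto simp: M.in_mball simp del: mspace_cfunspace)
    have "norm (y \<xi> - urysohn E \<Omega> K (h f) \<xi>) \<le> e" if "\<xi> \<in> E" for \<xi>
    proof -
      have "f \<in> mspace (C_space E)" "y \<in> mspace (C_space E)"
        using sub F(2) f(1) y by blast+
      then have "mdist euclidean_metric (f \<xi>) (y \<xi>) \<le> e / 2"
        using f(2) that by (intro mdist_cfunspace_imp_mdist_le [of f "top_of_set E" _ y]) (auto simp del: mspace_cfunspace)
      then have "norm (y \<xi> - f \<xi>) \<le> e / 2"
        by (simp add: dist_norm norm_minus_commute)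
      then show ?thesis
        using h(2) [OF f(1) that] norm_diff_triangle_le [of "y \<xi>" "f \<xi>" "e / 2" "urysohn E \<Omega> K (h f) \<xi>" "e / 2"] by simp
    qed
    then show "\<exists>g\<in>h ` F. \<forall>\<xi>\<in>E. norm (y \<xi> - urysohn E \<Omega> K g \<xi>) \<le> e"
      using f(1) by blast
  qed (use F(1) h(1) in auto)
qed

text \<open>The parameters serve all \<open>y\<close> at once because only the finite net of continuous functions is
  discretized: \<open>\<gamma>\<close> exceeds the sup norm on \<open>\<Omega>\<close> of each of them, and on sets of diameter at most \<open>\<Delta>s\<close>
  each of them oscillates by at most \<open>\<eta>\<close>.\<close>

lemma urysohn_image_discretization:
  fixes K :: "'b::euclidean_space \<Rightarrow> 'k::euclidean_space \<Rightarrow> 'm::euclidean_space \<Rightarrow> 'n::euclidean_space"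
  assumes "compact E" "compact \<Omega>" "p > 1" "r > 0"
    "kernel_continuous E \<Omega> K" "kernel_lipschitz E \<Omega> K" "kernel_modulus E \<Omega> K" and e: "e > 0"
  obtains \<gamma> \<Delta>s \<delta>s \<sigma>s where "\<gamma> > 0" "\<Delta>s > 0" "\<delta>s > 0" "\<sigma>s > 0"
    "\<And>\<Delta> \<delta> \<sigma> M \<Omega>s q w S y. \<lbrakk>\<Delta> \<le> \<Delta>s; 0 < \<delta>; \<delta> \<le> \<delta>s; 0 < \<sigma>; \<sigma> \<le> \<sigma>s;
       finite_partition \<Delta> \<Omega> M \<Omega>s; uniform_partition \<gamma> \<delta> q w; finite_net \<sigma> (sphere 0 1) S;
       y \<in> urysohn_image E \<Omega> K p r\<rbrakk> \<Longrightarrow>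
     \<exists>y'\<in>discrete_image E \<Omega> K p r M \<Omega>s q w S. \<forall>\<xi>\<in>E. norm (y \<xi> - y' \<xi>) \<le> e"
proof -
  have ms: "\<Omega> \<in> lmeasurable"
    using assms(2) lmeasurable_compact by blast
  interpret finite_measure "lebesgue_on \<Omega>"
    using ms by (intro finite_measure_lebesgue_on)
  obtain G where G: "finite G" "\<And>g. g \<in> G \<Longrightarrow> continuous_on UNIV g \<and> g \<in> Lp_ball p r \<Omega>"
    and net: "\<And>y. y \<in> urysohn_image E \<Omega> K p r \<Longrightarrow>
      \<exists>g\<in>G. \<forall>\<xi>\<in>E. norm (y \<xi> - urysohn E \<Omega> K g \<xi>) \<le> e / 2"
    using urysohn_image_continuous_net [OF assms(1-7), of "e / 2"] e by auto
  obtain l where l: "l > 0"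
    and L: "\<And>x y \<xi>. \<lbrakk>x \<in> Lp_space p \<Omega>; y \<in> Lp_space p \<Omega>; \<xi> \<in> E\<rbrakk> \<Longrightarrow>
      norm (urysohn E \<Omega> K x \<xi> - urysohn E \<Omega> K y \<xi>) \<le> l * (LINT s|lebesgue_on \<Omega>. norm (x s - y s))"
    by (rule urysohn_lipschitz [OF assms(2,3,5,6)]) (rule that; blast)
  define \<mu> where "\<mu> = measure lebesgue \<Omega>"
  \<comment> \<open>The oscillation counts twice, the radial and the angular grid once each: hence \<open>4 \<eta>\<close> below. The
    summand 1 keeps the denominator positive when \<open>\<Omega>\<close> is a null set.\<close>
  define \<eta> where "\<eta> = e / (8 * (l * \<mu> + 1))"
  have l\<mu>: "l * \<mu> \<ge> 0" using l by (simp add: \<mu>_def)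
  then have \<eta>: "\<eta> > 0" using e by (simp add: \<eta>_def)
  have "l * (4 * \<eta> * \<mu>) = (l * \<mu>) / (l * \<mu> + 1) * (e / 2)"
    using l\<mu> by (simp add: \<eta>_def field_simps)
  also have "\<dots> \<le> 1 * (e / 2)"
    using l\<mu> e by (intro mult_right_mono) auto
  finally have \<eta>e: "l * (4 * \<eta> * \<mu>) \<le> e / 2" by simp
  have "\<exists>B d. d > 0 \<and> (\<forall>s\<in>\<Omega>. norm (g s) \<le> B) \<and>
      (\<forall>s\<in>\<Omega>. \<forall>t\<in>\<Omega>. dist s t < d \<longrightarrow> norm (g s - g t) \<le> \<eta>)" if "g \<in> G" for g
  proof -
    have g: "continuous_on \<Omega> g"
      using G(2) [OF that] by (auto intro: continuous_on_subset)
    obtain B where "\<forall>s\<in>\<Omega>. norm (g s) \<le> B"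
      using compact_imp_bounded [OF compact_continuous_image [OF g assms(2)]] by (auto simp: bounded_iff)
    moreover obtain d where "d > 0" "\<forall>s\<in>\<Omega>. \<forall>t\<in>\<Omega>. dist t s < d \<longrightarrow> dist (g t) (g s) < \<eta>"
      using compact_uniformly_continuous [OF g assms(2)] \<eta> unfolding uniformly_continuous_on_def by blast
    ultimately show ?thesis by (metis dist_norm less_imp_le)
  qed
  then obtain B d where d: "\<And>g. g \<in> G \<Longrightarrow> d g > 0"
    and B: "\<And>g s. \<lbrakk>g \<in> G; s \<in> \<Omega>\<rbrakk> \<Longrightarrow> norm (g s) \<le> B g"
    and osc: "\<And>g s t. \<lbrakk>g \<in> G; s \<in> \<Omega>; t \<in> \<Omega>; dist s t < d g\<rbrakk> \<Longrightarrow> norm (g s - g t) \<le> \<eta>"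
    by metis
  \<comment> \<open>A common bound of the net; the summand 1 makes it positive even if all \<open>B g\<close> vanish.\<close>
  define \<gamma> where "\<gamma> = 1 + (\<Sum>g\<in>G. \<bar>B g\<bar>)"
  define D where "D = Min (insert 1 (d ` G))"
  have \<gamma>: "\<gamma> > 0" by (simp add: \<gamma>_def add_pos_nonneg sum_nonneg)
  have B\<gamma>: "norm (g s) \<le> \<gamma>" if "g \<in> G" "s \<in> \<Omega>" for g s
    using B [OF that] member_le_sum [of g G "\<lambda>g. \<bar>B g\<bar>"] that(1) G(1) by (simp add: \<gamma>_def)
  have D: "D > 0" using d G(1) by (auto simp: D_def)
  have Dd: "D \<le> d g" if "g \<in> G" for g
    using that G(1) by (simp add: D_def)
  show thesis
  proof (rule that [of \<gamma> "D / 2" \<eta> "\<eta> / \<gamma>"])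
    fix \<Delta> \<delta> \<sigma> :: real and M q :: nat and \<Omega>s w and S :: "'m set" and y
    assume \<Delta>: "\<Delta> \<le> D / 2" and \<delta>: "0 < \<delta>" "\<delta> \<le> \<eta>" and \<sigma>: "0 < \<sigma>" "\<sigma> \<le> \<eta> / \<gamma>"
      and part: "finite_partition \<Delta> \<Omega> M \<Omega>s" and w: "uniform_partition \<gamma> \<delta> q w"
      and S: "finite_net \<sigma> (sphere 0 1) S" and y: "y \<in> urysohn_image E \<Omega> K p r"
    obtain g where g: "g \<in> G" and yg: "\<forall>\<xi>\<in>E. norm (y \<xi> - urysohn E \<Omega> K g \<xi>) \<le> e / 2"
      using net [OF y] by blast
    have gb: "g \<in> Lp_ball p r \<Omega>" using G(2) [OF g] by simp
    have osc': "norm (g s - g t) \<le> \<eta>" if "s \<in> \<Omega>" "t \<in> \<Omega>" "dist s t \<le> \<Delta>" for s t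
      using osc [OF g that(1,2)] Dd [OF g] that(3) \<Delta> D by linarith
    obtain z where z: "z \<in> discrete_Lp_ball p r \<Omega> M \<Omega>s q w S"
      and gz: "\<And>s. s \<in> \<Omega> \<Longrightarrow> norm (g s - z s) \<le> 2 * \<eta> + \<delta> + \<gamma> * \<sigma>"
      by (rule discrete_Lp_ball_approx [OF assms(3,4) gb B\<gamma> [OF g] part osc' w \<delta>(1) \<gamma> S
            less_imp_le [OF \<sigma>(1)] less_imp_le [OF \<eta>]])
        (assumption+, (rule that; blast))
    have "\<gamma> * \<sigma> \<le> \<eta>" using \<sigma>(2) \<gamma> by (simp add: field_simps)
    then have gz4: "norm (g s - z s) \<le> 4 * \<eta>" if "s \<in> \<Omega>" for s
      using gz [OF that] \<delta>(2) by linarith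
    have zs: "z \<in> Lp_space p \<Omega>" and gs: "g \<in> Lp_space p \<Omega>"
      using z gb by (auto simp: discrete_Lp_ball_def Lp_ball_def)
    then have "(\<lambda>s. g s - z s) \<in> borel_measurable (lebesgue_on \<Omega>)"
      by (auto simp: Lp_space_def)
    then have "integrable (lebesgue_on \<Omega>) (\<lambda>s. g s - z s)"
      by (rule integrable_const_bound [rotated, where B = "4 * \<eta>"]) (use gz4 in auto)
    then have "(LINT s|lebesgue_on \<Omega>. norm (g s - z s)) \<le> (LINT s|lebesgue_on \<Omega>. 4 * \<eta>)"
      using gz4 by (intro integral_mono) auto
    also have "\<dots> = 4 * \<eta> * \<mu>"
      using ms by (simp add: measure_restrict_space \<mu>_def)
    finally have "l * (LINT s|lebesgue_on \<Omega>. norm (g s - z s)) \<le> e / 2"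
      using \<eta>e l by (meson mult_left_mono less_imp_le order_trans)
    then have "norm (urysohn E \<Omega> K g \<xi> - urysohn E \<Omega> K z \<xi>) \<le> e / 2" if "\<xi> \<in> E" for \<xi>
      using L [OF gs zs that] by linarith
    then have "norm (y \<xi> - urysohn E \<Omega> K z \<xi>) \<le> e" if "\<xi> \<in> E" for \<xi>
      using norm_diff_triangle_le [OF yg [rule_format, OF that], of "urysohn E \<Omega> K z \<xi>" "e / 2"] that by simp
    then show "\<exists>y'\<in>discrete_image E \<Omega> K p r M \<Omega>s q w S. \<forall>\<xi>\<in>E. norm (y \<xi> - y' \<xi>) \<le> e"
      using z by (auto simp: discrete_image_def)
  qed (use \<gamma> D \<eta> in auto)
qed

lemma hausdorff_distance_images_le:
  fixes K :: "'b::euclidean_space \<Rightarrow> 'k::euclidean_space \<Rightarrow> 'm::euclidean_space \<Rightarrow> 'n::euclidean_space"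
  assumes "compact E" "compact \<Omega>" "p > 1"
    "kernel_continuous E \<Omega> K" "kernel_lipschitz E \<Omega> K" "kernel_modulus E \<Omega> K" and "e \<ge> 0"
    and approx: "\<And>y. y \<in> urysohn_image E \<Omega> K p r \<Longrightarrow>
      \<exists>y'\<in>discrete_image E \<Omega> K p r M \<Omega>s q w S. \<forall>\<xi>\<in>E. norm (y \<xi> - y' \<xi>) \<le> e"
  shows "hausdorff_distance (C_space E) (urysohn_image E \<Omega> K p r)
      (discrete_image E \<Omega> K p r M \<Omega>s q w S) \<le> ennreal e"
proof (rule hausdorff_distance_le)
  note sub = urysohn_image_subset_cfunspace [OF assms(1-6)]
  show "\<exists>y'\<in>discrete_image E \<Omega> K p r M \<Omega>s q w S. mdist (C_space E) y y' \<le> e"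
    if "y \<in> urysohn_image E \<Omega> K p r" for y
    using approx [OF that] \<open>e \<ge> 0\<close> by (auto simp: dist_norm intro!: mdist_cfunspace_le elim!: rev_bexI)
  show "\<exists>y\<in>urysohn_image E \<Omega> K p r. mdist (C_space E) y' y \<le> e"
    if "y' \<in> discrete_image E \<Omega> K p r M \<Omega>s q w S" for y'
    using subsetD [OF sub(1) that] \<open>e \<ge> 0\<close> by (intro bexI [of _ y'] mdist_cfunspace_le) auto
qed

text \<open>From \<open>(a, y(a))\<close> one passes to \<open>(\<xi>\<^sub>i, y(\<xi>\<^sub>i))\<close>, where \<open>\<xi>\<^sub>i\<close> is the sample point of the cell of \<open>a\<close>, and
  then to \<open>(\<xi>\<^sub>i, y'(\<xi>\<^sub>i))\<close> for a nearby discrete \<open>y'\<close>. The Euclidean distance of pairs is bounded by the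
  sum of the distances of the components.\<close>

lemma hausdorff_distance_funnels_le:
  fixes K :: "'b::euclidean_space \<Rightarrow> 'k::euclidean_space \<Rightarrow> 'm::euclidean_space \<Rightarrow> 'n::euclidean_space"
  assumes sub: "discrete_image E \<Omega> K p r M \<Omega>s q w S \<subseteq> urysohn_image E \<Omega> K p r"
    and part: "finite_partition \<Delta> E N Es" and \<xi>: "\<And>i. i \<in> {1..N} \<Longrightarrow> \<xi> i \<in> Es i"
    and nonneg: "\<Delta> \<ge> 0" "e \<ge> 0" "e' \<ge> 0"
    and equi: "\<And>y a b. \<lbrakk>y \<in> urysohn_image E \<Omega> K p r; a \<in> E; b \<in> E; norm (a - b) \<le> \<Delta>\<rbrakk> \<Longrightarrow>
      norm (y a - y b) \<le> e"
    and approx: "\<And>y. y \<in> urysohn_image E \<Omega> K p r \<Longrightarrow>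
      \<exists>y'\<in>discrete_image E \<Omega> K p r M \<Omega>s q w S. \<forall>\<xi>\<in>E. norm (y \<xi> - y' \<xi>) \<le> e'"
  shows "hausdorff_distance euclidean_metric (integral_funnel E \<Omega> K p r)
      (discrete_funnel E \<Omega> K p r M \<Omega>s q w S N \<xi>) \<le> ennreal (\<Delta> + e + e')"
proof (rule hausdorff_distance_le)
  have Es: "\<And>i. i \<in> {1..N} \<Longrightarrow> Es i \<subseteq> E" and un: "E = (\<Union>i\<in>{1..N}. Es i)"
    and diam: "\<And>i a b. \<lbrakk>i \<in> {1..N}; a \<in> Es i; b \<in> Es i\<rbrakk> \<Longrightarrow> dist a b \<le> \<Delta>"
    using part diameter_bounded_bound order_trans unfolding finite_partition_def by blast+
  show "\<exists>v\<in>discrete_funnel E \<Omega> K p r M \<Omega>s q w S N \<xi>. mdist euclidean_metric u v \<le> \<Delta> + e + e'"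
    if ufun: "u \<in> integral_funnel E \<Omega> K p r" for u
  proof -
    obtain a y where a: "a \<in> E" and y: "y \<in> urysohn_image E \<Omega> K p r" and u: "u = (a, y a)"
      using ufun by (auto simp: integral_funnel_def)
    obtain i where i: "i \<in> {1..N}" "a \<in> Es i" using a un by auto
    then have \<xi>E: "\<xi> i \<in> E" and d: "dist a (\<xi> i) \<le> \<Delta>"
      using Es \<xi> diam by blast+
    obtain y' where y': "y' \<in> discrete_image E \<Omega> K p r M \<Omega>s q w S" "norm (y (\<xi> i) - y' (\<xi> i)) \<le> e'"
      using approx [OF y] \<xi>E by blast
    have "norm (y a - y (\<xi> i)) \<le> e"
      using equi [OF y a \<xi>E] d by (simp add: dist_norm)
    then have "dist (y a) (y' (\<xi> i)) \<le> e + e'"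
      using norm_diff_triangle_le y'(2) by (simp add: dist_norm) 
    then have "dist u (\<xi> i, y' (\<xi> i)) \<le> \<Delta> + e + e'"
      using d sqrt_sum_squares_le_sum [of "dist a (\<xi> i)" "dist (y a) (y' (\<xi> i))"]
      by (simp add: u dist_Pair_Pair)
    moreover have "(\<xi> i, y' (\<xi> i)) \<in> discrete_funnel E \<Omega> K p r M \<Omega>s q w S N \<xi>"
      using i(1) y'(1) by (auto simp: discrete_funnel_def)
    ultimately show ?thesis by (auto intro!: bexI)
  qed
  show "\<exists>u\<in>integral_funnel E \<Omega> K p r. mdist euclidean_metric v u \<le> \<Delta> + e + e'"
    if "v \<in> discrete_funnel E \<Omega> K p r M \<Omega>s q w S N \<xi>" for v
  proof -
    have "v \<in> integral_funnel E \<Omega> K p r"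
      using that sub Es \<xi> unfolding discrete_funnel_def integral_funnel_def by blast
    then show ?thesis using nonneg by (auto intro!: bexI [of _ v])
  qed
qed

theorem theorem3p1:
  fixes E :: "(real ^ 'b) set" and \<Omega> :: "(real ^ 'k) set"
    and K :: "real ^ 'b \<Rightarrow> real ^ 'k \<Rightarrow> real ^ 'm \<Rightarrow> real ^ 'n"
    and p r :: real
  assumes "compact E" and "E \<noteq> {}" and "compact \<Omega>" and "\<Omega> \<noteq> {}"
    and "p > 1" and "r > 0"
    and "kernel_continuous E \<Omega> K" and "kernel_lipschitz E \<Omega> K" and "kernel_modulus E \<Omega> K"
  shows "\<forall>\<epsilon>>0. \<exists>\<gamma>s>0. \<exists>\<Delta>s>0. \<exists>\<delta>s>0. \<exists>\<sigma>s>0.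
    \<forall>\<Delta>\<in>{0<..\<Delta>s}. \<forall>\<delta>\<in>{0<..\<delta>s}. \<forall>\<sigma>\<in>{0<..\<sigma>s}.
    \<forall>(M::nat) \<Omega>s (N::nat) Es \<xi> (q::nat) w S\<sigma>.
      finite_partition \<Delta> \<Omega> M \<Omega>s \<and>
      finite_partition \<Delta> E N Es \<and>
      (\<forall>i\<in>{1..N}. \<xi> i \<in> Es i) \<and>
      uniform_partition \<gamma>s \<delta> q w \<and>
      finite_net \<sigma> (sphere 0 1) S\<sigma> \<longrightarrow>
      hausdorff_distance (C_space E)
        (urysohn_image E \<Omega> K p r) (discrete_image E \<Omega> K p r M \<Omega>s q w S\<sigma>) < ennreal \<epsilon> \<and>
      hausdorff_distance euclidean_metric
        (integral_funnel E \<Omega> K p r) (discrete_funnel E \<Omega> K p r M \<Omega>s q w S\<sigma> N \<xi>) < ennreal \<epsilon>"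
proof (intro allI impI)
  fix \<epsilon> :: real assume \<epsilon>: "\<epsilon> > 0"
  then have \<epsilon>4: "\<epsilon> / 4 > 0" by simp
  obtain \<gamma> \<Delta>1 \<delta>s \<sigma>s where pos: "\<gamma> > 0" "\<Delta>1 > 0" "\<delta>s > 0" "\<sigma>s > 0"
    and approx: "\<And>\<Delta> \<delta> \<sigma> M \<Omega>s q w S y. \<lbrakk>\<Delta> \<le> \<Delta>1; 0 < \<delta>; \<delta> \<le> \<delta>s; 0 < \<sigma>; \<sigma> \<le> \<sigma>s;
       finite_partition \<Delta> \<Omega> M \<Omega>s; uniform_partition \<gamma> \<delta> q w; finite_net \<sigma> (sphere 0 1) S;
       y \<in> urysohn_image E \<Omega> K p r\<rbrakk> \<Longrightarrow>
     \<exists>y'\<in>discrete_image E \<Omega> K p r M \<Omega>s q w S. \<forall>\<xi>\<in>E. norm (y \<xi> - y' \<xi>) \<le> \<epsilon> / 4"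
  proof (rule urysohn_image_discretization [OF assms(1,3,5-9) \<epsilon>4], goal_cases)
    case prems: 1
    show thesis by (rule prems(1) [OF prems(2-)])
  qed
  obtain d where d: "d > 0"
    and equi: "\<And>y a b. \<lbrakk>y \<in> urysohn_image E \<Omega> K p r; a \<in> E; b \<in> E; norm (a - b) < d\<rbrakk> \<Longrightarrow>
      norm (y a - y b) < \<epsilon> / 4"
    by (rule urysohn_image_equicontinuous [OF assms(3,5) less_imp_le [OF assms(6)] assms(7-9) \<epsilon>4]) (rule that; blast)
  \<comment> \<open>The mesh enters three times: in the discretization, in the modulus of the \<open>y\<close>, and directly as
    the distance of \<open>\<xi>\<close> to the sample point. Each contributes at most \<open>\<epsilon> / 4\<close>.\<close>
  define \<Delta>s where "\<Delta>s = min \<Delta>1 (min (d / 2) (\<epsilon> / 4))"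
  have \<Delta>s: "\<Delta>s > 0" "\<Delta>s \<le> \<Delta>1" "\<Delta>s < d" "\<Delta>s \<le> \<epsilon> / 4"
    using pos(2) d \<epsilon> by (auto simp: \<Delta>s_def)
  show "\<exists>\<gamma>s>0. \<exists>\<Delta>s>0. \<exists>\<delta>s>0. \<exists>\<sigma>s>0.
    \<forall>\<Delta>\<in>{0<..\<Delta>s}. \<forall>\<delta>\<in>{0<..\<delta>s}. \<forall>\<sigma>\<in>{0<..\<sigma>s}.
    \<forall>(M::nat) \<Omega>s (N::nat) Es \<xi> (q::nat) w S\<sigma>.
      finite_partition \<Delta> \<Omega> M \<Omega>s \<and>
      finite_partition \<Delta> E N Es \<and>
      (\<forall>i\<in>{1..N}. \<xi> i \<in> Es i) \<and>
      uniform_partition \<gamma>s \<delta> q w \<and>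
      finite_net \<sigma> (sphere 0 1) S\<sigma> \<longrightarrow>
      hausdorff_distance (C_space E)
        (urysohn_image E \<Omega> K p r) (discrete_image E \<Omega> K p r M \<Omega>s q w S\<sigma>) < ennreal \<epsilon> \<and>
      hausdorff_distance euclidean_metric
        (integral_funnel E \<Omega> K p r) (discrete_funnel E \<Omega> K p r M \<Omega>s q w S\<sigma> N \<xi>) < ennreal \<epsilon>"
  proof (rule exI [of _ \<gamma>], rule conjI [OF pos(1)], rule exI [of _ \<Delta>s], rule conjI [OF \<Delta>s(1)],
      rule exI [of _ \<delta>s], rule conjI [OF pos(3)], rule exI [of _ \<sigma>s], rule conjI [OF pos(4)],
      intro ballI allI impI, elim conjE)
    fix \<Delta> \<delta> \<sigma> :: real and M N q :: nat and \<Omega>s Es \<xi> w and S\<sigma> :: "(real ^ 'm) set"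
    assume range: "\<Delta> \<in> {0<..\<Delta>s}" "\<delta> \<in> {0<..\<delta>s}" "\<sigma> \<in> {0<..\<sigma>s}"
      and part: "finite_partition \<Delta> \<Omega> M \<Omega>s" "finite_partition \<Delta> E N Es"
      and \<xi>: "\<forall>i\<in>{1..N}. \<xi> i \<in> Es i"
      and w: "uniform_partition \<gamma> \<delta> q w" and S: "finite_net \<sigma> (sphere 0 1) S\<sigma>"
    have appr: "\<exists>y'\<in>discrete_image E \<Omega> K p r M \<Omega>s q w S\<sigma>. \<forall>\<xi>\<in>E. norm (y \<xi> - y' \<xi>) \<le> \<epsilon> / 4"
      if "y \<in> urysohn_image E \<Omega> K p r" for y
      using range \<Delta>s by (intro approx [OF _ _ _ _ _ part(1) w S that]) auto
    have "hausdorff_distance (C_space E)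
        (urysohn_image E \<Omega> K p r) (discrete_image E \<Omega> K p r M \<Omega>s q w S\<sigma>) \<le> ennreal (\<epsilon> / 4)"
      using \<epsilon> by (intro hausdorff_distance_images_le appr assms) auto
    also have "\<dots> < ennreal \<epsilon>" using \<epsilon> by (simp add: ennreal_less_iff)
    finally have 1: "hausdorff_distance (C_space E)
        (urysohn_image E \<Omega> K p r) (discrete_image E \<Omega> K p r M \<Omega>s q w S\<sigma>) < ennreal \<epsilon>" .
    have "hausdorff_distance euclidean_metric
        (integral_funnel E \<Omega> K p r) (discrete_funnel E \<Omega> K p r M \<Omega>s q w S\<sigma> N \<xi>)
        \<le> ennreal (\<Delta> + \<epsilon> / 4 + \<epsilon> / 4)"
    proof (rule hausdorff_distance_funnels_le [OF _ part(2)])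
      show "discrete_image E \<Omega> K p r M \<Omega>s q w S\<sigma> \<subseteq> urysohn_image E \<Omega> K p r"
        by (rule urysohn_image_subset_cfunspace(1) [OF assms(1,3,5,7-9)])
      show "norm (y a - y b) \<le> \<epsilon> / 4"
        if "y \<in> urysohn_image E \<Omega> K p r" "a \<in> E" "b \<in> E" "norm (a - b) \<le> \<Delta>" for y a b
        using equi [OF that(1-3)] that(4) range(1) \<Delta>s(3) by fastforce
    qed (use \<xi> range(1) \<epsilon> appr in auto)
    also have "\<dots> < ennreal \<epsilon>"
      using range(1) \<Delta>s(4) \<epsilon> by (intro ennreal_lessI) auto
    finally have 2: "hausdorff_distance euclidean_metric
        (integral_funnel E \<Omega> K p r) (discrete_funnel E \<Omega> K p r M \<Omega>s q w S\<sigma> N \<xi>) < ennreal \<epsilon>" .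
    show "hausdorff_distance (C_space E)
        (urysohn_image E \<Omega> K p r) (discrete_image E \<Omega> K p r M \<Omega>s q w S\<sigma>) < ennreal \<epsilon> \<and>
      hausdorff_distance euclidean_metric
        (integral_funnel E \<Omega> K p r) (discrete_funnel E \<Omega> K p r M \<Omega>s q w S\<sigma> N \<xi>) < ennreal \<epsilon>"
      using 1 2 by simp
  qed
qed

end
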